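(* Let $p$ be an odd prime, $\mathbf{s}=(s_1,\dots,s_{p-1})$ a tuple of non-negative integers, and $\mathrm{G}$ a finite graph. If there is an $\mathcal{A}_p$-algebra structure on $\mathrm{A}_p(\mathbf{s},\mathrm{G})\otimes\mathbb{Z}/p$, then $s_p\chi(\mathrm{G})\le s_1$, where $s_1$ is the first coordinate of $\mathbf{s}$.
   Context: Graphs are finite simple graphs; $\mathrm{G}$ has vertex set $\{y_1,\dots,y_m\}$ and is regarded as a simplicial complex of dimension $\le 1$. For a simplicial complex $K$ on a finite vertex set $V=\{v_1,\dots,v_N\}$ and a function $\phi:V\to 2\mathbb{Z}_{>0}$, the Stanley-Reisner ring is the graded ring $\mathrm{SR}(K,\phi)=\mathbb{Z}[v_1,\dots,v_N]/I_K$ with $|v_i|=\phi(v_i)$, where $I_K$ is generated by the monomials $v_{i_1}\cdots v_{i_k}$ (distinct $i_j$) with $\{v_{i_1},\dots,v_{i_k}\}\notin K$. $\mathrm{A}_p(\mathbf{s},\mathrm{G})=\mathrm{SR}(K,\phi)$ with $K=\Delta^{s_1-1}*\cdots*\Delta^{s_{p-1}-1}*\mathrm{G}$ (simplicial join), where $\Delta^{s_k-1}$ is the full simplex on $s_k$ vertices $x^{(k)}_1,\dots,x^{(k)}_{s_k}$ (empty if $s_k=0$), $\phi(x^{(k)}_i)=2k+2$ for $1\le k\le p-1$, and $\phi(y_j)=2p+2$. $\mathcal{A}_p$ is the mod-$p$ Steenrod algebra. An $\mathcal{A}_p$-algebra structure on a graded commutative $\mathbb{Z}/p$-algebra $R$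 concentrated in even degrees means an unstable algebra structure: a left $\mathcal{A}_p$-module structure with operations $P^a:R^d\to R^{d+2a(p-1)}$, $P^0=\mathrm{id}$, satisfying the Adem relations, the Cartan formula, $P^a(x)=x^p$ if $|x|=2a$, and $P^a(x)=0$ if $2a>|x|$. For a field $\mathbf{k}$, an $n$-span coloring of $\mathrm{G}$ is a function $f:V(\mathrm{G})\to\mathbf{k}^n\setminus\{0\}$ such that $f(v)\notin\langle f(N(v))\rangle$ for every vertex $v$, where $N(v)$ is the set of neighbors of $v$ and $\langle\cdot\rangle$ is the $\mathbf{k}$-linear span. $s_p\chi(\mathrm{G})$ is the smallest $n$ such that $\mathrm{G}$ admits an $n$-span coloring over $\mathbf{k}=\mathbb{F}_p$. *)

theory Defs
  imports
    "HOL-Algebra.QuotRing"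
    "HOL-Library.Poly_Mapping"
    "Graph_Theory.Pair_Digraph"
    "Jordan_Normal_Form.VS_Connect"
    "Berlekamp_Zassenhaus.Finite_Field"
begin

hide_const (open) Multiset.mult

section \<open>Graded rings\<close>

text \<open>
  A graded ring carries, besides its ring structure, the family of its homogeneous parts:
  \<open>grade R d\<close> is the subgroup \<open>R\<^sup>d\<close>.
\<close>

record 'a graded_ring = "'a ring" +
  grade :: "nat \<Rightarrow> 'a set"

definition graded_quotient :: "('a, 'b) graded_ring_scheme \<Rightarrow> 'a set \<Rightarrow> 'a set graded_ring" where
  "graded_quotient R I =
    \<lparr>carrier = carrier (R Quot I), mult = mult (R Quot I), one = one (R Quot I),
     zero = zero (R Quot I), add = add (R Quot I),
     grade = (\<lambda>d. (\<lambda>x. I +>\<^bsub>R\<^esub> x) ` grade R d)\<rparr>"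

text \<open>The tensor product \<open>R \<otimes> \<int>/p\<close> over the integers, realised as \<open>R/pR\<close>.\<close>

definition tensor_Zmod :: "('a, 'b) graded_ring_scheme \<Rightarrow> nat \<Rightarrow> 'a set graded_ring" where
  "tensor_Zmod R p = graded_quotient R (PIdl\<^bsub>R\<^esub> ([p] \<cdot>\<^bsub>R\<^esub> \<one>\<^bsub>R\<^esub>))"


section \<open>Stanley-Reisner rings\<close>

type_synonym 'v monomial = "'v \<Rightarrow>\<^sub>0 nat"

definition monomial_degree :: "('v \<Rightarrow> nat) \<Rightarrow> 'v monomial \<Rightarrow> nat" where
  "monomial_degree \<phi> m = (\<Sum>v\<in>Poly_Mapping.keys m. Poly_Mapping.lookup m v * \<phi> v)"

text \<open>The graded polynomial ring \<open>\<int>[V]\<close> in which the variable \<open>v\<close> has degree \<open>\<phi> v\<close>.\<close>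

definition int_poly_ring :: "'v set \<Rightarrow> ('v \<Rightarrow> nat) \<Rightarrow> ('v monomial \<Rightarrow>\<^sub>0 int) graded_ring" where
  "int_poly_ring V \<phi> =
    \<lparr>carrier = {f. \<forall>m\<in>Poly_Mapping.keys f. Poly_Mapping.keys m \<subseteq> V},
     mult = (*), one = 1, zero = 0, add = (+),
     grade = (\<lambda>d. {f. \<forall>m\<in>Poly_Mapping.keys f. Poly_Mapping.keys m \<subseteq> V \<and>
       monomial_degree \<phi> m = d})\<rparr>"

definition squarefree_monomial :: "'v set \<Rightarrow> 'v monomial \<Rightarrow>\<^sub>0 int" where
  "squarefree_monomial \<sigma> = Poly_Mapping.single (\<Sum>v\<in>\<sigma>. Poly_Mapping.single v 1) 1"

text \<open>A simplicial complex on a finite vertex set \<open>V\<close> is given by the set \<open>K\<close> of its simplices,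
  the empty simplex included.\<close>

definition stanley_reisner_ideal ::
    "'v set \<Rightarrow> 'v set set \<Rightarrow> ('v \<Rightarrow> nat) \<Rightarrow> ('v monomial \<Rightarrow>\<^sub>0 int) set" where
  "stanley_reisner_ideal V K \<phi> =
    Idl\<^bsub>int_poly_ring V \<phi>\<^esub> {squarefree_monomial \<sigma> | \<sigma>. \<sigma> \<subseteq> V \<and> \<sigma> \<notin> K}"

definition SR :: "'v set \<Rightarrow> 'v set set \<Rightarrow> ('v \<Rightarrow> nat) \<Rightarrow> ('v monomial \<Rightarrow>\<^sub>0 int) set graded_ring" where
  "SR V K \<phi> = graded_quotient (int_poly_ring V \<phi>) (stanley_reisner_ideal V K \<phi>)"


section \<open>The graded rings attached to a graph\<close>

text \<open>Simple graphs are the symmetric loop-free finite pair digraphs of the locale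
  \<^locale>\<open>pair_graph\<close>: the edge joining \<open>u\<close> and \<open>v\<close> is the pair of arcs \<open>(u, v)\<close> and \<open>(v, u)\<close>.\<close>

definition neighbors :: "'v pair_pre_digraph \<Rightarrow> 'v \<Rightarrow> 'v set" where
  "neighbors G v = {w. (v, w) \<in> parcs G}"

definition graph_complex :: "'v pair_pre_digraph \<Rightarrow> 'v set set" where
  "graph_complex G = {{}} \<union> {{v} | v. v \<in> pverts G} \<union> {{u, v} | u v. (u, v) \<in> parcs G}"

text \<open>\<open>X k i\<close> is the \<open>i\<close>-th vertex of the \<open>k\<close>-th simplex (both counted from 1), and \<open>Y\<close> embeds the
  vertices of the graph.\<close>

datatype 'v gen = X nat nat | Y 'v

text \<open>The join of two complexes whose vertex sets are disjoint.\<close>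

definition simplicial_join :: "'a set set \<Rightarrow> 'a set set \<Rightarrow> 'a set set" where
  "simplicial_join K L = {\<sigma> \<union> \<tau> | \<sigma> \<tau>. \<sigma> \<in> K \<and> \<tau> \<in> L}"

definition simplex_vertices :: "(nat \<Rightarrow> nat) \<Rightarrow> nat \<Rightarrow> 'v gen set" where
  "simplex_vertices s k = X k ` {1..s k}"

definition A_vertices :: "nat \<Rightarrow> (nat \<Rightarrow> nat) \<Rightarrow> 'v pair_pre_digraph \<Rightarrow> 'v gen set" where
  "A_vertices p s G = (\<Union>k\<in>{1..p - 1}. simplex_vertices s k) \<union> Y ` pverts G"

definition A_complex :: "nat \<Rightarrow> (nat \<Rightarrow> nat) \<Rightarrow> 'v pair_pre_digraph \<Rightarrow> 'v gen set set" where
  "A_complex p s G =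
    foldr simplicial_join (map (\<lambda>k. Pow (simplex_vertices s k)) [1..<p]) ((`) Y ` graph_complex G)"

primrec A_degree :: "nat \<Rightarrow> 'v gen \<Rightarrow> nat" where
  "A_degree p (X k i) = 2 * k + 2"
| "A_degree p (Y v) = 2 * p + 2"

text \<open>The tuple \<open>s\<close> is a function of which only the values at \<open>1, \<dots>, p - 1\<close> are used.\<close>

definition A_ring ::
    "nat \<Rightarrow> (nat \<Rightarrow> nat) \<Rightarrow> 'v pair_pre_digraph \<Rightarrow> ('v gen monomial \<Rightarrow>\<^sub>0 int) set graded_ring" where
  "A_ring p s G = SR (A_vertices p s G) (A_complex p s G) (A_degree p)"


section \<open>Unstable algebras over the Steenrod algebra\<close>

text \<open>
  \<open>P a\<close> is the \<open>a\<close>-th reduced power on a graded \<open>\<int>/p\<close>-algebra \<open>R\<close> concentrated in even degrees,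
  \<open>p\<close> odd.  The Bockstein raises degrees by one, so it acts as zero on such an algebra and imposes no
  condition.  Linearity over \<open>\<int>/p\<close> amounts to additivity.  In the Adem relations \<open>a < p * b\<close>
  and \<open>j \<le> a div p\<close> force \<open>j < b\<close>, so the subtractions of natural numbers are not truncated.
\<close>

locale steenrod_structure =
  fixes p :: nat and R (structure) and P :: "nat \<Rightarrow> 'a \<Rightarrow> 'a"
  assumes closed: "x \<in> carrier R \<Longrightarrow> P a x \<in> carrier R"
    and additive: "\<lbrakk>x \<in> carrier R; y \<in> carrier R\<rbrakk> \<Longrightarrow> P a (x \<oplus> y) = P a x \<oplus> P a y"
    and degree: "x \<in> grade R d \<Longrightarrow> P a x \<in> grade R (d + 2 * a * (p - 1))"
    and P_0: "x \<in> carrier R \<Longrightarrow> P 0 x = x"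
    and Adem: "\<lbrakk>0 < a; a < p * b; x \<in> carrier R\<rbrakk> \<Longrightarrow>
      P a (P b x) = (\<Oplus>j\<in>{0..a div p}.
        [((-1) ^ (a + j) * int (((p - 1) * (b - j) - 1) choose (a - p * j)))] \<cdot>
          P (a + b - j) (P j x))"
    and Cartan: "\<lbrakk>x \<in> carrier R; y \<in> carrier R\<rbrakk> \<Longrightarrow>
      P a (x \<otimes> y) = (\<Oplus>i\<in>{0..a}. P i x \<otimes> P (a - i) y)"
    and power: "x \<in> grade R (2 * a) \<Longrightarrow> P a x = x [^] p"
    and unstable: "\<lbrakk>x \<in> grade R d; d < 2 * a\<rbrakk> \<Longrightarrow> P a x = \<zero>"


section \<open>Span colorings\<close>

text \<open>The space \<open>k\<^sup>n\<close> is \<^term>\<open>carrier_vec n\<close>, and the span is taken over the field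
  of type \<open>'k\<close>.\<close>

definition span_coloring :: "nat \<Rightarrow> 'v pair_pre_digraph \<Rightarrow> ('v \<Rightarrow> 'k::field vec) \<Rightarrow> bool" where
  "span_coloring n G f \<longleftrightarrow>
    (\<forall>v\<in>pverts G. f v \<in> carrier_vec n - {0\<^sub>v n} \<and>
      f v \<notin> LinearCombinations.module.span class_ring (module_vec TYPE('k) n) (f ` neighbors G v))"

text \<open>The smallest \<open>n\<close> exists: assigning distinct unit vectors to the vertices gives a
  coloring with \<open>n = card (pverts G)\<close>.\<close>

definition span_chromatic_number :: "'k::field itself \<Rightarrow> 'v pair_pre_digraph \<Rightarrow> nat" where
  "span_chromatic_number _ G = (LEAST n. \<exists>f :: 'v \<Rightarrow> 'k vec. span_coloring n G f)"

end

(*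
   Write x_i for the generators of degree 4, y_v for those attached to the vertices, and let
   a_v(i) be the coefficient of y_v in P^1 x_i and c_v(i) the coefficient of x_i y_v^(p-1) in
   P^p y_v.  The Adem relation P^1 P^p = P^(p+1) gives P^1 P^p y_v = y_v^p, and comparing
   coefficients, c_v . a_v = 1.  The colors are the vectors a_v, modified at leaves, and the point is
   that c_v . a_w = 0 for an edge vw whose end w has another neighbor.

   Fix an edge vw and discard all generators except y_v, y_w and, to first order, the x_i.  By degree
   reasons P^p y_u = sum_i x_i H_u,i + O(x^2) with forms H_u,i in y_v, y_w of degree p - 1 for u = v, w.
   Let M be the 2 x 2 matrix of forms with rows u and columns t given by M_ut = sum_i H_u,i a_t(i).
   Then M y = y^(p), which makes det M nonzero and a_v, a_w linearly independent.  The derivation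
   D = P^p P^1 - P^1 P^p maps P^p y_u to P^p (y_u^p), which vanishes to first order, because
   P^1 P^p P^p y_u = P^1 P^(2p-1) P^1 y_u = 0; and D x_i = P^p P^1 x_i = sum_t a_t(i) P^p y_t to first
   order.  So D M = - M^2.  Together with M y = y^(p) this forces D y = y^(p).  If w has
   another neighbor u, then y_v is killed by y_w y_u, hence P^p y_v contains no x_i y_w^(p-1), and the
   highest power of y_w in the equation D M = - M^2 shows that M is triangular: M_vw = 0, which contains
   c_v . a_w as its coefficient of y_v^(p-1).
*)

theory Submission
  imports Defs "HOL-Computational_Algebra.Formal_Power_Series"
begin

hide_const (open) up_ring.coeff up_ring.monom

section \<open>Derivations of bivariate polynomials\<close>

text \<open>Setting the x_i to 0 does not commute with the operations: \<open>P^1 x_i\<close>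
  involves the y_t, and this failure is exactly what the pairing of c with a records. Hence the
  operations are never pushed to a quotient ring. Statements are about additive functionals on
  \<open>Q\<close>, such as the value or the coefficient of one x_j in \<open>P^a z\<close>; two
  functionals with the same Leibniz rule are compared on generators, where degrees leave little to
  check.

  The degrees fit together as follows: |y| = 2p + 2 makes \<open>P^(p+1) y\<close> a pth power;
  \<open>P^p y\<close> has degree 2p^2 + 2 = 4 + (2p + 2)(p - 1), room for one x_i and p - 1 factors
  y; D has degree (2p + 2)(p - 1), so it preserves residues modulo 2p + 2.

  The equation D y = y^(p) arises because D kills pth powers: D (M y) = 0 gives M (D y) = M^2 y = M
  y^(p), and M cancels.

  An edge whose end w has no further neighbor gives no orthogonality. There the independence of a_v
  and a_w protects the color of the leaf, and the modification of a_w protects the color of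
  v.\<close>

definition bivar_deriv :: "'a::idom poly poly \<Rightarrow> 'a poly poly \<Rightarrow> 'a poly poly \<Rightarrow> 'a poly poly" where
  "bivar_deriv F1 F2 f = F1 * map_poly pderiv f + F2 * pderiv f"

lemma map_poly_pderiv_add: "map_poly pderiv (f + g) = map_poly pderiv f + map_poly pderiv (g :: 'a::idom poly poly)"
  by (rule poly_eqI) (simp add: coeff_map_poly pderiv_add)

lemma map_poly_pderiv_mult:
  "map_poly pderiv (f * g) = map_poly pderiv f * g + f * map_poly pderiv (g :: 'a::idom poly poly)"
proof (rule poly_eqI)
  fix n
  show "coeff (map_poly pderiv (f * g)) n = coeff (map_poly pderiv f * g + f * map_poly pderiv g) n"
    unfolding coeff_add coeff_mult
    by (simp add: coeff_map_poly coeff_mult pderiv_sum pderiv_mult sum.distrib add.commute mult.commute)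
qed

lemma bivar_deriv_add: "bivar_deriv F1 F2 (f + g) = bivar_deriv F1 F2 f + bivar_deriv F1 F2 g"
  by (simp add: bivar_deriv_def map_poly_pderiv_add pderiv_add algebra_simps)

lemma bivar_deriv_mult:
  "bivar_deriv F1 F2 (f * g) = bivar_deriv F1 F2 f * g + f * bivar_deriv F1 F2 g"
  by (simp add: bivar_deriv_def map_poly_pderiv_mult pderiv_mult algebra_simps)

lemma map_poly_pderiv_1: "map_poly pderiv (1 :: 'a::idom poly poly) = 0"
  by (rule poly_eqI) (simp add: coeff_map_poly)

text \<open>In \<open>'a poly poly\<close> the inner variable stands for y_v and the outer one for
  y_w: \<open>map_poly pderiv\<close> differentiates in the inner variable, \<open>pderiv\<close> in
  the outer one.\<close>

lemma bivar_deriv_vars: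
  "bivar_deriv F1 F2 [:[:0, 1:]:] = F1" "bivar_deriv F1 F2 [:0, 1:] = F2"
  by (simp_all add: bivar_deriv_def map_poly_pderiv_1 map_poly_pCons pderiv_pCons flip: one_pCons)

text \<open>With vanishing determinant, multiplying the two equations would put y1^p y2^p into the
  ideal generated by y1^(p+1) and y2^(p+1); the coefficient of y1^p y2^p shows that it is not
  there.\<close>

lemma bivar_matrix_det_nonzero:
  fixes A B A' B' :: "'a::idom poly poly"
  defines "y1 \<equiv> [:[:0, 1:]:]" and "y2 \<equiv> [:0, 1:]"
  assumes e1: "y1 * A + y2 * B = y1 ^ p" and e2: "y1 * B' + y2 * A' = y2 ^ p"
  shows "A * A' \<noteq> B * B'"
proof
  assume eq: "A * A' = B * B'"
  have "(y1 * A) * (y2 * A') = (y1 ^ p - y2 * B) * (y2 ^ p - y1 * B')"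
    using e1 e2 by (simp add: algebra_simps flip: e1 e2)
  also have "(y1 * A) * (y2 * A') = y1 * y2 * (B * B')"
    using eq by (simp add: algebra_simps)
  finally have "y1 ^ p * y2 ^ p = y1 ^ Suc p * B' + y2 ^ Suc p * B"
    by (simp add: algebra_simps)
  moreover have y1: "y1 ^ n = [:monom 1 n:]" for n
    by (induction n) (simp_all add: y1_def monom_Suc one_pCons)
  moreover have y2: "y2 ^ n = monom 1 n" for n
    by (simp add: y2_def monom_altdef)
  ultimately have "coeff ([:monom 1 p:] * monom 1 p) p = coeff ([:monom 1 (Suc p):] * B' + monom 1 (Suc p) * B) p"
    by metis
  then have "monom 1 p = monom 1 (Suc p) * coeff B' p"
    by (simp add: coeff_monom_mult)
  then have "coeff (monom 1 p :: 'a poly) p = coeff (monom 1 (Suc p) * coeff B' p) p"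
    by simp
  then show False
    by (simp only: coeff_monom_mult) simp
qed

text \<open>The first two equations force the derivation to be \<open>y \<mapsto> y\<^sup>p\<close> on both variables; comparing the
  coefficients of the highest power of \<open>y2\<close> in the last one then kills \<open>B\<close>.\<close>

lemma bivar_riccati_triangular:
  fixes A B A' B' F1 F2 :: "'a::idom poly poly"
  defines "y1 \<equiv> [:[:0, 1:]:]" and "y2 \<equiv> [:0, 1:]"
  assumes p: "1 < p" "of_nat p = (0 :: 'a)" "\<And>n. 0 < n \<Longrightarrow> n < p \<Longrightarrow> of_nat n \<noteq> (0 :: 'a)"
    and e1: "y1 * A + y2 * B = y1 ^ p" and e2: "y1 * B' + y2 * A' = y2 ^ p"
    and deg: "degree A < p" "degree B < p" "degree A' < p" "degree B' < p"
    and A: "coeff A (p - 1) = 0"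
    and dA: "bivar_deriv F1 F2 A = - (A * A + B * B')"
    and dB: "bivar_deriv F1 F2 B = - (A * B + B * A')"
    and dB': "bivar_deriv F1 F2 B' = - (B' * A + A' * B')"
    and dA': "bivar_deriv F1 F2 A' = - (B' * B + A' * A')"
  shows "B = 0"
proof -
  let ?d = "bivar_deriv F1 F2"
  have nz: "A * A' - B * B' \<noteq> 0"
    using bivar_matrix_det_nonzero[of A B p B' A'] e1 e2 unfolding y1_def y2_def by simp
  have p0: "of_nat p = (0 :: 'a poly poly)"
    using p(2) by (simp add: of_nat_poly)
  have dpow: "?d (f ^ n) = of_nat n * f ^ (n - 1) * ?d f" for f n
  proof (induction n)
    case 0
    have "?d 1 = 0" by (simp add: bivar_deriv_def map_poly_pderiv_1)
    then show ?case by simp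
  next
    case (Suc n)
    then show ?case by (cases n) (simp_all add: bivar_deriv_mult algebra_simps)
  qed
  have d1: "?d y1 = F1" and d2: "?d y2 = F2"
    unfolding y1_def y2_def by (rule bivar_deriv_vars)+
  \<comment> \<open>Differentiating \<open>e1\<close>, whose right side is a pth power, and
    inserting \<open>dA\<close>, \<open>dB\<close> yields one row of M (F - y^(p)) = 0.\<close>
  have r1: "A * (F1 - y1 ^ p) + B * (F2 - y2 ^ p) = 0"
  proof -
    have "?d (y1 * A + y2 * B) = 0" unfolding e1 by (simp add: dpow p0)
    then have "F1 * A + F2 * B = A * (y1 * A + y2 * B) + B * (y1 * B' + y2 * A')"
      by (simp add: bivar_deriv_add bivar_deriv_mult d1 d2 dA dB algebra_simps)
    then show ?thesis unfolding e1 e2 by (simp add: algebra_simps)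
  qed
  have r2: "B' * (F1 - y1 ^ p) + A' * (F2 - y2 ^ p) = 0"
  proof -
    have "?d (y1 * B' + y2 * A') = 0" unfolding e2 by (simp add: dpow p0)
    then have "F1 * B' + F2 * A' = B' * (y1 * A + y2 * B) + A' * (y1 * B' + y2 * A')"
      by (simp add: bivar_deriv_add bivar_deriv_mult d1 d2 dA' dB' algebra_simps)
    then show ?thesis unfolding e1 e2 by (simp add: algebra_simps)
  qed
  \<comment> \<open>Cramer's rule: the rows \<open>r1\<close> and \<open>r2\<close> are combined
    with the entries of the adjugate matrix.\<close>
  have "(A * A' - B * B') * u = A' * (A * u + B * v) - B * (B' * u + A' * v)" for u v
    by (simp add: algebra_simps)
  from this[of "F1 - y1 ^ p" "F2 - y2 ^ p"] have "(A * A' - B * B') * (F1 - y1 ^ p) = 0"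
    unfolding r1 r2 by simp
  then have F1: "F1 = y1 ^ p" using nz by simp
  have "(A * A' - B * B') * v = A * (B' * u + A' * v) - B' * (A * u + B * v)" for u v
    by (simp add: algebra_simps)
  from this[of "F2 - y2 ^ p" "F1 - y1 ^ p"] have "(A * A' - B * B') * (F2 - y2 ^ p) = 0"
    unfolding r1 r2 by simp
  then have F2: "F2 = y2 ^ p" using nz by simp
  have y1: "y1 ^ n = [:monom 1 n:]" for n
    by (induction n) (simp_all add: y1_def monom_Suc one_pCons)
  have y2: "y2 ^ n = monom 1 n" for n
    by (simp add: y2_def monom_altdef)
  \<comment> \<open>The coefficient of y2^p is read off in \<open>e2\<close>, and below in
    \<open>e1\<close>; the summand with the factor y1 has y2-degree less than p and does not
    contribute.\<close>
  have A'top: "coeff A' (p - 1) = 1"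
  proof -
    have "coeff (y1 * B' + y2 * A') p = coeff (y2 ^ p) p" using e2 by simp
    moreover have "coeff B' p = 0" using deg(4) by (simp add: coeff_eq_0)
    ultimately show ?thesis using \<open>1 < p\<close>
      unfolding y2 by (simp add: y1_def y2_def coeff_pCons split: nat.splits)
  qed
  have Btop: "coeff B (p - 1) = 0"
  proof -
    have "coeff (y1 * A + y2 * B) p = coeff (y1 ^ p) p" using e1 by simp
    moreover have "coeff A p = 0" using deg(1) by (simp add: coeff_eq_0)
    ultimately show ?thesis using \<open>1 < p\<close>
      unfolding y1 by (simp add: y1_def y2_def coeff_pCons split: nat.splits)
  qed
  show "B = 0"
  proof (rule ccontr)
    assume "B \<noteq> 0"
    define k where "k = degree B"
    have bk: "coeff B k \<noteq> 0" using \<open>B \<noteq> 0\<close> by (simp add: k_def)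
    then have "k \<noteq> p - 1" using Btop by auto
    then have k: "k + 1 < p" using deg(2) by (simp add: k_def)
    \<comment> \<open>Both sides of \<open>dB\<close> are compared at y2^(k+p-1). On the right, A +
      A' has coefficient 1 at y2^(p-1), which gives minus the leading coefficient of B; on the left,
      y2^p d/dy2 multiplies that coefficient by k. Hence k + 1 = 0 in \<open>'a\<close>, although 0
      < k + 1 < p.\<close>
    have "degree (A + A') \<le> p - 1" using deg by (intro degree_add_le) auto
    then have "coeff (B * (A + A')) (k + (p - 1)) = coeff B k * coeff (A + A') (p - 1)"
      using coeff_mult_degree_sum[of B "A + A'"] 
      by (smt (verit, best) \<open>coeff A' (p - 1) = 1\<close> A add.left_neutral coeff_add k_def le_degree le_antisym zero_neq_one)
    then have "coeff (- (A * B + B * A')) (k + (p - 1)) = - coeff B k"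
      using A A'top by (simp add: algebra_simps)
    moreover have "coeff (?d B) (k + (p - 1)) = of_nat k * coeff B k"
    proof -
      have "coeff (map_poly pderiv B) (k + (p - 1)) = 0"
        using \<open>1 < p\<close> by (simp add: coeff_map_poly k_def coeff_eq_0)
      moreover have "coeff (monom 1 p * pderiv B) (k + (p - 1)) = of_nat k * coeff B k"
      proof (cases k)
        case 0
        then obtain b where "B = [:b:]" unfolding k_def by (rule degree_eq_zeroE)
        then have "pderiv B = 0" by simp
        then show ?thesis using 0 by simp
      next
        case (Suc m)
        then have "k + (p - 1) = m + p" using \<open>1 < p\<close> by simp
        then show ?thesis using Suc by (simp add: coeff_monom_mult coeff_pderiv)
      qed
      ultimately show ?thesis
        unfolding bivar_deriv_def F1 F2 y1 y2 by simp
    qed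
    ultimately have "of_nat k * coeff B k = - coeff B k"
      using dB by metis
    then have "of_nat (k + 1) * coeff B k = 0"
      by (simp add: distrib_right)
    then have "of_nat (k + 1) = (0 :: 'a poly)" using bk by simp
    then have "of_nat (k + 1) = (0 :: 'a)" by (simp only: of_nat_poly) (simp del: of_nat_Suc of_nat_add)
    then show False using p(3)[of "k + 1"] k by simp
  qed
qed

section \<open>Evaluation of integer polynomials\<close>

definition monomial_eval :: "('v \<Rightarrow> 'c::comm_ring_1) \<Rightarrow> 'v monomial \<Rightarrow> 'c" where
  "monomial_eval \<theta> m = (\<Prod>v\<in>Poly_Mapping.keys m. \<theta> v ^ Poly_Mapping.lookup m v)"

definition int_poly_eval :: "('v \<Rightarrow> 'c::comm_ring_1) \<Rightarrow> ('v monomial \<Rightarrow>\<^sub>0 int) \<Rightarrow> 'c" where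
  "int_poly_eval \<theta> f = (\<Sum>m\<in>Poly_Mapping.keys f. of_int (Poly_Mapping.lookup f m) * monomial_eval \<theta> m)"

lemma monomial_eval_superset:
  assumes "finite A" "Poly_Mapping.keys m \<subseteq> A"
  shows "monomial_eval \<theta> m = (\<Prod>v\<in>A. \<theta> v ^ Poly_Mapping.lookup m v)"
  unfolding monomial_eval_def using assms
  by (intro prod.mono_neutral_left) (auto simp: in_keys_iff)

lemma monomial_eval_0 [simp]: "monomial_eval \<theta> 0 = 1"
  by (simp add: monomial_eval_def)

lemma monomial_eval_single [simp]: "monomial_eval \<theta> (Poly_Mapping.single v n) = \<theta> v ^ n"
  by (cases "n = 0") (simp_all add: monomial_eval_def)

lemma monomial_eval_add: "monomial_eval \<theta> (m + n) = monomial_eval \<theta> m * monomial_eval \<theta> n"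
proof -
  let ?A = "Poly_Mapping.keys m \<union> Poly_Mapping.keys n"
  have "Poly_Mapping.keys (m + n) \<subseteq> ?A" by (rule keys_add)
  then show ?thesis
    by (simp add: monomial_eval_superset[of ?A] lookup_add power_add prod.distrib)
qed

lemma int_poly_eval_superset:
  assumes "finite A" "Poly_Mapping.keys f \<subseteq> A"
  shows "int_poly_eval \<theta> f = (\<Sum>m\<in>A. of_int (Poly_Mapping.lookup f m) * monomial_eval \<theta> m)"
  unfolding int_poly_eval_def using assms
  by (intro sum.mono_neutral_left) (auto simp: in_keys_iff)

lemma int_poly_eval_single [simp]:
  "int_poly_eval \<theta> (Poly_Mapping.single m c) = of_int c * monomial_eval \<theta> m"
  by (cases "c = 0") (simp_all add: int_poly_eval_def)

lemma int_poly_eval_0 [simp]: "int_poly_eval \<theta> 0 = 0"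
  by (simp add: int_poly_eval_def)

lemma int_poly_eval_1 [simp]: "int_poly_eval \<theta> 1 = 1"
  by (simp add: int_poly_eval_single flip: single_one)

lemma int_poly_eval_add: "int_poly_eval \<theta> (f + g) = int_poly_eval \<theta> f + int_poly_eval \<theta> g"
proof -
  let ?A = "Poly_Mapping.keys f \<union> Poly_Mapping.keys g"
  have "Poly_Mapping.keys (f + g) \<subseteq> ?A" by (rule keys_add)
  then show ?thesis
    by (simp add: int_poly_eval_superset[of ?A] lookup_add algebra_simps sum.distrib)
qed

lemma int_poly_eval_diff: "int_poly_eval \<theta> (f - g) = int_poly_eval \<theta> f - int_poly_eval \<theta> g"
  using int_poly_eval_add[of \<theta> "f - g" g] by simp

text \<open>An integer polynomial is an element of the free abelian group on its monomials, so
  \<open>frag_induction\<close> reduces a biadditive identity to single monomials.\<close>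

lemma int_poly_eval_mult: "int_poly_eval \<theta> (f * g) = int_poly_eval \<theta> f * int_poly_eval \<theta> g"
proof -
  have "int_poly_eval \<theta> (Poly_Mapping.single m 1 * g) = monomial_eval \<theta> m * int_poly_eval \<theta> g" for m
    using subset_UNIV
    by (induction g rule: frag_induction)
      (simp_all add: mult_single monomial_eval_add int_poly_eval_diff algebra_simps)
  with subset_UNIV show ?thesis
    by (induction f rule: frag_induction) (simp_all add: int_poly_eval_diff algebra_simps)
qed

lemma int_poly_eval_hom:
  fixes \<theta> :: "'v \<Rightarrow> 'c::comm_ring_1" and h :: "'c \<Rightarrow> 'd::comm_ring_1"
  assumes "\<And>x y. h (x - y) = h x - h y" "\<And>x y. h (x * y) = h x * h y" "h 1 = 1"
  shows "h (int_poly_eval \<theta> f) = int_poly_eval (\<lambda>v. h (\<theta> v)) f"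
proof -
  have h0: "h 0 = 0" using assms(1)[of 0 0] by simp
  have pow: "h (x ^ n) = h x ^ n" for x and n :: nat
    by (induction n) (simp_all add: assms)
  have "h (\<Prod>v\<in>A. g v) = (\<Prod>v\<in>A. h (g v))" for A :: "'v set" and g
    by (induction A rule: infinite_finite_induct) (simp_all add: assms)
  then have "h (monomial_eval \<theta> m) = monomial_eval (\<lambda>v. h (\<theta> v)) m" for m
    by (simp add: monomial_eval_def pow)
  with subset_UNIV show ?thesis
    by (induction f rule: frag_induction) (simp_all add: h0 assms int_poly_eval_diff)
qed

text \<open>One variable is split off at a time, since the Leibniz rules below are used for
  multiplication by a single generator.\<close>

lemma monomial_induct [consumes 1, case_names zero add]:
  assumes "Poly_Mapping.keys m \<subseteq> V" and "S 0"
    and "\<And>m v. \<lbrakk>Poly_Mapping.keys m \<subseteq> V; v \<in> V; S m\<rbrakk> \<Longrightarrow> S (m + Poly_Mapping.single v (1::nat))"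
  shows "S m"
  using assms(1)
proof (induction "\<Sum>v\<in>Poly_Mapping.keys m. Poly_Mapping.lookup m v" arbitrary: m rule: less_induct)
  case less
  show ?case
  proof (cases "m = 0")
    case True
    then show ?thesis using assms(2) by simp
  next
    case False
    then obtain v where v: "v \<in> Poly_Mapping.keys m" by (metis ex_in_conv keys_eq_empty)
    define n where "n = m - Poly_Mapping.single v 1"
    have m: "m = n + Poly_Mapping.single v 1"
      unfolding n_def using v
      by (intro poly_mapping_eqI) (auto simp: lookup_add lookup_minus lookup_single in_keys_iff when_def)
    have sub: "Poly_Mapping.keys n \<subseteq> Poly_Mapping.keys m"
      unfolding n_def by (auto simp: in_keys_iff lookup_minus)
    have "(\<Sum>v\<in>Poly_Mapping.keys n. Poly_Mapping.lookup n v)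
      = (\<Sum>v\<in>Poly_Mapping.keys m. Poly_Mapping.lookup n v)"
      using sub by (intro sum.mono_neutral_left) (auto simp: in_keys_iff)
    also have "\<dots> < (\<Sum>v\<in>Poly_Mapping.keys m. Poly_Mapping.lookup m v)"
      using v by (intro sum_strict_mono_ex1 bexI[of _ v]) (simp_all add: m lookup_add)
    finally have "S n" using less sub by auto
    then show ?thesis using assms(3)[of n v] sub less.prems v m by auto
  qed
qed

lemma monomial_degree_add: "monomial_degree \<phi> (m + n) = monomial_degree \<phi> m + monomial_degree \<phi> n"
proof -
  have *: "monomial_degree \<phi> k = (\<Sum>v\<in>Poly_Mapping.keys m \<union> Poly_Mapping.keys n. Poly_Mapping.lookup k v * \<phi> v)"
    if "Poly_Mapping.keys k \<subseteq> Poly_Mapping.keys m \<union> Poly_Mapping.keys n" for k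
    unfolding monomial_degree_def using that
    by (intro sum.mono_neutral_left) (auto simp: in_keys_iff)
  show ?thesis
    using keys_add[of m n] by (simp add: * lookup_add algebra_simps sum.distrib)
qed

lemma monomial_degree_0 [simp]: "monomial_degree \<phi> 0 = 0"
  by (simp add: monomial_degree_def)

lemma monomial_degree_single [simp]: "monomial_degree \<phi> (Poly_Mapping.single v n) = n * \<phi> v"
  by (cases "n = 0") (simp_all add: monomial_degree_def)

lemma int_poly_ring_simps [simp]:
  "carrier (int_poly_ring V \<phi>) = {f. \<forall>m\<in>Poly_Mapping.keys f. Poly_Mapping.keys m \<subseteq> V}"
  "\<one>\<^bsub>int_poly_ring V \<phi>\<^esub> = 1" "\<zero>\<^bsub>int_poly_ring V \<phi>\<^esub> = 0"
  "x \<otimes>\<^bsub>int_poly_ring V \<phi>\<^esub> y = x * y" "x \<oplus>\<^bsub>int_poly_ring V \<phi>\<^esub> y = x + y"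
  by (simp_all add: int_poly_ring_def)

lemma int_poly_ring_cring: "cring (int_poly_ring V \<phi>)"
proof -
  let ?R = "int_poly_ring V \<phi>"
  have add: "f + g \<in> carrier ?R" if "f \<in> carrier ?R" "g \<in> carrier ?R" for f g
    using that keys_add[of f g] by auto
  have mult: "f * g \<in> carrier ?R" if "f \<in> carrier ?R" "g \<in> carrier ?R" for f g
  proof -
    have "Poly_Mapping.keys m \<subseteq> V" if m: "m \<in> Poly_Mapping.keys (f * g)" for m
    proof -
      obtain a b where "m = a + b" "a \<in> Poly_Mapping.keys f" "b \<in> Poly_Mapping.keys g"
        using m keys_mult[of f g] by blast
      then show ?thesis
        using \<open>f \<in> carrier ?R\<close> \<open>g \<in> carrier ?R\<close> keys_add[of a b] by fastforce
    qed
    then show ?thesis by simp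
  qed
  have "abelian_group ?R"
  proof (rule abelian_groupI)
    fix f assume "f \<in> carrier ?R"
    then show "\<exists>g\<in>carrier ?R. g \<oplus>\<^bsub>?R\<^esub> f = \<zero>\<^bsub>?R\<^esub>"
      by (intro bexI[of _ "- f"]) auto
  next
    fix f g assume "f \<in> carrier ?R" "g \<in> carrier ?R"
    then show "f \<oplus>\<^bsub>?R\<^esub> g \<in> carrier ?R"
      unfolding int_poly_ring_simps(5) by (rule add)
  qed (simp_all add: add.assoc add.commute)
  moreover have "comm_monoid ?R"
  proof (rule comm_monoidI)
    fix f g assume "f \<in> carrier ?R" "g \<in> carrier ?R"
    then show "f \<otimes>\<^bsub>?R\<^esub> g \<in> carrier ?R"
      unfolding int_poly_ring_simps(4) by (rule mult)
  qed (simp_all add: mult.assoc mult.commute)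
  ultimately show ?thesis
    by (rule cringI) (simp add: distrib_right)
qed

text \<open>\<open>graded_quotient\<close> builds a new record from the operations of
  \<open>R Quot I\<close>, so the ring axioms are transported one by one.\<close>

lemma graded_quotient_cring:
  assumes "cring R" "ideal I R"
  shows "cring (graded_quotient R I)"
    and "(\<lambda>x. I +>\<^bsub>R\<^esub> x) \<in> Ring.ring_hom R (graded_quotient R I)"
    and "carrier (graded_quotient R I) = (\<lambda>x. I +>\<^bsub>R\<^esub> x) ` carrier R"
    and "grade (graded_quotient R I) d = (\<lambda>x. I +>\<^bsub>R\<^esub> x) ` grade R d"
proof -
  interpret I: ideal I R by fact
  interpret Q: cring "R Quot I" by (rule I.quotient_is_cring) fact
  let ?Q = "graded_quotient R I"
  have "abelian_group ?Q"
  proof (rule abelian_groupI)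
    fix x assume "x \<in> carrier ?Q"
    then show "\<exists>y\<in>carrier ?Q. y \<oplus>\<^bsub>?Q\<^esub> x = \<zero>\<^bsub>?Q\<^esub>"
      using Q.l_neg Q.a_inv_closed unfolding graded_quotient_def by auto
  qed (simp_all add: graded_quotient_def Q.a_assoc, simp add: Q.a_comm)
  moreover have "comm_monoid ?Q"
    by (rule comm_monoidI) (simp_all add: graded_quotient_def Q.m_assoc, simp add: Q.m_comm)
  ultimately show "cring ?Q"
    by (rule cringI) (use Q.l_distr in \<open>simp add: graded_quotient_def\<close>)
  show "(\<lambda>x. I +>\<^bsub>R\<^esub> x) \<in> Ring.ring_hom R ?Q"
    using I.rcos_ring_hom by (simp add: graded_quotient_def Ring.ring_hom_def)
  show "carrier ?Q = (\<lambda>x. I +>\<^bsub>R\<^esub> x) ` carrier R"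
    by (auto simp: graded_quotient_def FactRing_def A_RCOSETS_defs a_r_coset_def)
  show "grade ?Q d = (\<lambda>x. I +>\<^bsub>R\<^esub> x) ` grade R d"
    by (simp add: graded_quotient_def)
qed

section \<open>Stanley-Reisner rings modulo a prime\<close>

text \<open>Elements of the tensor product are cosets of cosets. Naming the composite projection
  allows representatives to be taken in the integer polynomial ring at once.\<close>

definition sr_mod_class ::
    "'v set \<Rightarrow> 'v set set \<Rightarrow> ('v \<Rightarrow> nat) \<Rightarrow> nat \<Rightarrow> ('v monomial \<Rightarrow>\<^sub>0 int) \<Rightarrow> ('v monomial \<Rightarrow>\<^sub>0 int) set set" where
  "sr_mod_class V K \<phi> p f =
    (PIdl\<^bsub>SR V K \<phi>\<^esub> ([p] \<cdot>\<^bsub>SR V K \<phi>\<^esub> \<one>\<^bsub>SR V K \<phi>\<^esub>)) +>\<^bsub>SR V K \<phi>\<^esub>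
      (stanley_reisner_ideal V K \<phi> +>\<^bsub>int_poly_ring V \<phi>\<^esub> f)"

text \<open>Squarefree non-faces generate the Stanley-Reisner ideal, so these products decide
  whether evaluation at \<theta> kills it.\<close>

definition respects_complex :: "'v set \<Rightarrow> 'v set set \<Rightarrow> ('v \<Rightarrow> 'c::comm_ring_1) \<Rightarrow> bool" where
  "respects_complex V K \<theta> \<longleftrightarrow> (\<forall>\<sigma>\<subseteq>V. \<sigma> \<notin> K \<longrightarrow> (\<Prod>v\<in>\<sigma>. \<theta> v) = 0)"

lemma zero_graded_quotient: "\<zero>\<^bsub>graded_quotient R I\<^esub> = I"
  by (simp add: graded_quotient_def FactRing_def)

lemma keys_sum_single:
  assumes "finite \<sigma>"
  shows "Poly_Mapping.keys (\<Sum>v\<in>\<sigma>. Poly_Mapping.single v (Suc 0)) = \<sigma>"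
  using assms by (auto simp: in_keys_iff lookup_sum lookup_single when_def split: if_splits)

lemma int_poly_eval_squarefree_monomial:
  assumes "finite \<sigma>"
  shows "int_poly_eval \<theta> (squarefree_monomial \<sigma>) = (\<Prod>v\<in>\<sigma>. \<theta> v)"
proof -
  have "Poly_Mapping.lookup (\<Sum>v\<in>\<sigma>. Poly_Mapping.single v (Suc 0)) w = Suc 0" if "w \<in> \<sigma>" for w
    using that assms by (simp add: lookup_sum lookup_single when_def)
  then show ?thesis
    using assms by (simp add: squarefree_monomial_def monomial_eval_def keys_sum_single)
qed

lemma squarefree_monomial_carrier:
  assumes "finite V" "\<sigma> \<subseteq> V"
  shows "squarefree_monomial \<sigma> \<in> carrier (int_poly_ring V \<phi>)"
  using assms keys_sum_single[of \<sigma>] finite_subset[of \<sigma> V] by (simp add: squarefree_monomial_def)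

lemma stanley_reisner_ideal_ideal:
  assumes "finite V"
  shows "ideal (stanley_reisner_ideal V K \<phi>) (int_poly_ring V \<phi>)"
    and "\<lbrakk>\<sigma> \<subseteq> V; \<sigma> \<notin> K\<rbrakk> \<Longrightarrow> squarefree_monomial \<sigma> \<in> stanley_reisner_ideal V K \<phi>"
proof -
  interpret cring "int_poly_ring V \<phi>" by (rule int_poly_ring_cring)
  have sub: "{squarefree_monomial \<sigma> | \<sigma>. \<sigma> \<subseteq> V \<and> \<sigma> \<notin> K} \<subseteq> carrier (int_poly_ring V \<phi>)"
    using squarefree_monomial_carrier[OF assms] by blast
  show "ideal (stanley_reisner_ideal V K \<phi>) (int_poly_ring V \<phi>)"
    unfolding stanley_reisner_ideal_def by (rule genideal_ideal[OF sub])
  show "squarefree_monomial \<sigma> \<in> stanley_reisner_ideal V K \<phi>" if "\<sigma> \<subseteq> V" "\<sigma> \<notin> K"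
    unfolding stanley_reisner_ideal_def using genideal_self[OF sub] that by blast
qed

lemma int_poly_eval_stanley_reisner_ideal:
  assumes "finite V" "respects_complex V K \<theta>" "f \<in> stanley_reisner_ideal V K \<phi>"
  shows "int_poly_eval \<theta> f = 0"
proof -
  let ?Z = "int_poly_ring V \<phi>"
  interpret cring ?Z by (rule int_poly_ring_cring)
  let ?J = "{f \<in> carrier ?Z. int_poly_eval \<theta> f = 0}"
  have inv: "\<ominus>\<^bsub>?Z\<^esub> f = - f" if "f \<in> carrier ?Z" for f
    by (rule minus_equality) (use that in auto)
  have "subgroup ?J (add_monoid ?Z)"
  proof (rule add.subgroupI)
    fix f assume "f \<in> ?J"
    then show "\<ominus>\<^bsub>?Z\<^esub> f \<in> ?J"
      using int_poly_eval_diff[of \<theta> 0 f] by (auto simp: inv)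
  next
    fix f g assume "f \<in> ?J" "g \<in> ?J"
    then show "f \<oplus>\<^bsub>?Z\<^esub> g \<in> ?J"
      using a_closed[of f g] by (auto simp: int_poly_eval_add)
  qed auto
  then have "ideal ?J ?Z"
  proof (rule idealI[OF ring_axioms])
    fix f g assume "f \<in> ?J" "g \<in> carrier ?Z"
    then show "g \<otimes>\<^bsub>?Z\<^esub> f \<in> ?J" "f \<otimes>\<^bsub>?Z\<^esub> g \<in> ?J"
      using m_closed[of f g] m_closed[of g f] by (simp_all add: int_poly_eval_mult)
  qed
  moreover have "{squarefree_monomial \<sigma> | \<sigma>. \<sigma> \<subseteq> V \<and> \<sigma> \<notin> K} \<subseteq> ?J"
  proof clarify
    fix \<sigma> assume "\<sigma> \<subseteq> V" "\<sigma> \<notin> K"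
    moreover from \<open>\<sigma> \<subseteq> V\<close> have "finite \<sigma>" using assms(1) finite_subset by blast
    moreover have "squarefree_monomial \<sigma> \<in> carrier ?Z"
      using squarefree_monomial_carrier[OF assms(1) \<open>\<sigma> \<subseteq> V\<close>] .
    ultimately show "squarefree_monomial \<sigma> \<in> carrier ?Z \<and> int_poly_eval \<theta> (squarefree_monomial \<sigma>) = 0"
      using assms(2) by (simp add: int_poly_eval_squarefree_monomial respects_complex_def)
  qed
  ultimately have "stanley_reisner_ideal V K \<phi> \<subseteq> ?J"
    unfolding stanley_reisner_ideal_def by (rule genideal_minimal)
  then show ?thesis using assms(3) by auto
qed

text \<open>Equal classes have representatives that differ by k + h p with k in the Stanley-Reisner
  ideal, and both summands evaluate to 0 when p = 0 in \<open>'c\<close>. This is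
  \<open>sr_mod_class_eqD\<close>, which makes evaluation well defined on the tensor
  product.\<close>

lemma
  assumes "finite V"
  shows tensor_Zmod_SR_cring: "cring (tensor_Zmod (SR V K \<phi>) p)"
    and sr_mod_class_hom:
      "sr_mod_class V K \<phi> p \<in> Ring.ring_hom (int_poly_ring V \<phi>) (tensor_Zmod (SR V K \<phi>) p)"
    and carrier_tensor_Zmod_SR:
      "carrier (tensor_Zmod (SR V K \<phi>) p) = sr_mod_class V K \<phi> p ` carrier (int_poly_ring V \<phi>)"
    and grade_tensor_Zmod_SR:
      "grade (tensor_Zmod (SR V K \<phi>) p) d = sr_mod_class V K \<phi> p ` grade (int_poly_ring V \<phi>) d"
    and sr_mod_class_nonface:
      "\<lbrakk>\<sigma> \<subseteq> V; \<sigma> \<notin> K\<rbrakk> \<Longrightarrow> sr_mod_class V K \<phi> p (squarefree_monomial \<sigma>) = \<zero>\<^bsub>tensor_Zmod (SR V K \<phi>) p\<^esub>"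
    and sr_mod_class_char: "sr_mod_class V K \<phi> p (of_nat p) = \<zero>\<^bsub>tensor_Zmod (SR V K \<phi>) p\<^esub>"
    and sr_mod_class_eqD:
      "\<lbrakk>sr_mod_class V K \<phi> p f = sr_mod_class V K \<phi> p g;
        f \<in> carrier (int_poly_ring V \<phi>); g \<in> carrier (int_poly_ring V \<phi>);
        respects_complex V K \<theta>; of_nat p = (0 :: 'c)\<rbrakk>
        \<Longrightarrow> int_poly_eval \<theta> f = int_poly_eval (\<theta> :: _ \<Rightarrow> 'c::comm_ring_1) g"
proof -
  let ?Z = "int_poly_ring V \<phi>" and ?I = "stanley_reisner_ideal V K \<phi>" and ?S = "SR V K \<phi>"
  let ?J = "PIdl\<^bsub>?S\<^esub> ([p] \<cdot>\<^bsub>?S\<^esub> \<one>\<^bsub>?S\<^esub>)" and ?Q = "tensor_Zmod (SR V K \<phi>) p"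
  interpret Z: cring ?Z by (rule int_poly_ring_cring)
  interpret I: ideal ?I ?Z by (rule stanley_reisner_ideal_ideal(1)) fact
  note SR_quot = graded_quotient_cring[OF Z.cring_axioms I.ideal_axioms, folded SR_def]
  interpret S: cring ?S by (rule SR_quot(1))
  interpret J: ideal ?J ?S by (rule S.cgenideal_ideal) simp
  note Q_quot = graded_quotient_cring[OF S.cring_axioms J.ideal_axioms, folded tensor_Zmod_def]
  show Q: "cring ?Q" by (rule Q_quot(1))
  interpret Q: cring ?Q by fact
  have comp: "sr_mod_class V K \<phi> p = (\<lambda>x. ?J +>\<^bsub>?S\<^esub> x) \<circ> (\<lambda>x. ?I +>\<^bsub>?Z\<^esub> x)"
    by (auto simp: sr_mod_class_def)
  show hom: "sr_mod_class V K \<phi> p \<in> Ring.ring_hom ?Z ?Q"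
    unfolding comp by (rule ring_hom_trans[OF SR_quot(2) Q_quot(2)])
  show "carrier ?Q = sr_mod_class V K \<phi> p ` carrier ?Z"
    by (simp add: Q_quot(3) SR_quot(3) comp image_comp)
  show "grade ?Q d = sr_mod_class V K \<phi> p ` grade ?Z d"
    by (simp add: Q_quot(4) SR_quot(4) comp image_comp)
  interpret i: ring_hom_cring ?Z ?S "\<lambda>x. ?I +>\<^bsub>?Z\<^esub> x"
    by (rule ring_hom_cringI[OF Z.cring_axioms S.cring_axioms SR_quot(2)])
  interpret j: ring_hom_cring ?S ?Q "\<lambda>x. ?J +>\<^bsub>?S\<^esub> x"
    by (rule ring_hom_cringI[OF S.cring_axioms Q.cring_axioms Q_quot(2)])
  have nat_carrier: "(of_nat n :: 'a monomial \<Rightarrow>\<^sub>0 int) \<in> carrier ?Z" for n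
    by (simp flip: single_of_nat)
  have pone: "[p] \<cdot>\<^bsub>?S\<^esub> \<one>\<^bsub>?S\<^esub> = ?I +>\<^bsub>?Z\<^esub> of_nat p"
  proof (induction p)
    case 0
    then show ?case using i.hom_zero by simp
  next
    case (Suc p)
    have "?I +>\<^bsub>?Z\<^esub> (of_nat p \<oplus>\<^bsub>?Z\<^esub> \<one>\<^bsub>?Z\<^esub>) = (?I +>\<^bsub>?Z\<^esub> of_nat p) \<oplus>\<^bsub>?S\<^esub> (?I +>\<^bsub>?Z\<^esub> \<one>\<^bsub>?Z\<^esub>)"
      by (rule i.hom_add) (use nat_carrier in simp_all)
    with Suc show ?case using i.hom_one by (simp add: add.commute)
  qed
  show "sr_mod_class V K \<phi> p (squarefree_monomial \<sigma>) = \<zero>\<^bsub>?Q\<^esub>" if "\<sigma> \<subseteq> V" "\<sigma> \<notin> K"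
  proof -
    have "squarefree_monomial \<sigma> \<in> ?I"
      using stanley_reisner_ideal_ideal(2)[OF assms] that by blast
    then have "?I +>\<^bsub>?Z\<^esub> squarefree_monomial \<sigma> = \<zero>\<^bsub>?S\<^esub>"
      by (simp add: I.a_rcos_const SR_def graded_quotient_def FactRing_def)
    then show ?thesis using j.hom_zero by (simp add: comp)
  qed
  show "sr_mod_class V K \<phi> p (of_nat p) = \<zero>\<^bsub>?Q\<^esub>"
  proof -
    have "?I +>\<^bsub>?Z\<^esub> of_nat p \<in> ?J"
      unfolding pone[symmetric] by (rule S.cgenideal_self[OF S.add.nat_pow_closed[OF S.one_closed]])
    moreover have "\<zero>\<^bsub>?Q\<^esub> = ?J"
      unfolding tensor_Zmod_def by (rule zero_graded_quotient)
    ultimately show ?thesis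
      unfolding sr_mod_class_def by (metis J.a_rcos_const)
  qed
  show "int_poly_eval \<theta> f = int_poly_eval \<theta> g"
    if eq: "sr_mod_class V K \<phi> p f = sr_mod_class V K \<phi> p g"
      and fg: "f \<in> carrier ?Z" "g \<in> carrier ?Z"
      and \<theta>: "respects_complex V K \<theta>" "of_nat p = (0 :: 'c)" for \<theta> :: "'a \<Rightarrow> 'c"
  proof -
    have "?I +>\<^bsub>?Z\<^esub> f \<in> ?J +>\<^bsub>?S\<^esub> (?I +>\<^bsub>?Z\<^esub> g)"
      using J.a_rcos_self[OF i.hom_closed[OF fg(1)]] eq unfolding sr_mod_class_def by (simp only:)
    then obtain y where y: "y \<in> ?J" "?I +>\<^bsub>?Z\<^esub> f = y \<oplus>\<^bsub>?S\<^esub> (?I +>\<^bsub>?Z\<^esub> g)"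
      unfolding a_r_coset_def'[of ?S] by blast
    then obtain h where h: "h \<in> carrier ?Z" "y = (?I +>\<^bsub>?Z\<^esub> h) \<otimes>\<^bsub>?S\<^esub> (?I +>\<^bsub>?Z\<^esub> of_nat p)"
      unfolding cgenideal_def pone SR_quot(3) by blast
    note p = nat_carrier[of p]
    have "?I +>\<^bsub>?Z\<^esub> f = ?I +>\<^bsub>?Z\<^esub> (h \<otimes>\<^bsub>?Z\<^esub> of_nat p \<oplus>\<^bsub>?Z\<^esub> g)"
      unfolding i.hom_add[OF Z.m_closed[OF h(1) p] fg(2)] i.hom_mult[OF h(1) p] y(2) h(2) ..
    then have "f \<in> ?I +>\<^bsub>?Z\<^esub> (h \<otimes>\<^bsub>?Z\<^esub> of_nat p \<oplus>\<^bsub>?Z\<^esub> g)"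
      using I.a_rcos_self[OF fg(1)] by metis
    then obtain k where "k \<in> ?I" "f = k + (h * of_nat p + g)"
      unfolding a_r_coset_def' int_poly_ring_simps by blast
    moreover have "int_poly_eval \<theta> (of_nat p) = of_nat p"
      using int_poly_eval_single[of \<theta> 0 "int p"] by (simp flip: single_of_nat)
    ultimately show ?thesis
      using int_poly_eval_stanley_reisner_ideal[OF assms \<theta>(1)] \<theta>(2)
      by (simp add: int_poly_eval_add int_poly_eval_mult)
  qed
qed

section \<open>Steenrod operations under evaluations\<close>

locale sr_steenrod =
  fixes p :: nat and V :: "'v set" and K :: "'v set set" and \<phi> :: "'v \<Rightarrow> nat"
    and P :: "nat \<Rightarrow> ('v monomial \<Rightarrow>\<^sub>0 int) set set \<Rightarrow> ('v monomial \<Rightarrow>\<^sub>0 int) set set"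
  assumes steenrod: "steenrod_structure p (tensor_Zmod (SR V K \<phi>) p) P"
    and finite_V: "finite V" and prime_p: "prime p" and odd_p: "odd p"
begin

abbreviation "Z \<equiv> int_poly_ring V \<phi>"
abbreviation "Q \<equiv> tensor_Zmod (SR V K \<phi>) p"
abbreviation "cls \<equiv> sr_mod_class V K \<phi> p"

sublocale steenrod_structure p Q P by (rule steenrod)
sublocale Z: cring Z by (rule int_poly_ring_cring)
sublocale Q: cring Q by (rule tensor_Zmod_SR_cring[OF finite_V])
sublocale cls: ring_hom_cring Z Q cls
  by (rule ring_hom_cringI[OF Z.cring_axioms Q.cring_axioms sr_mod_class_hom[OF finite_V]])

definition mon :: "'v monomial \<Rightarrow> ('v monomial \<Rightarrow>\<^sub>0 int) set set" where
  "mon m = cls (Poly_Mapping.single m 1)"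

definition gen :: "'v \<Rightarrow> ('v monomial \<Rightarrow>\<^sub>0 int) set set" where
  "gen v = mon (Poly_Mapping.single v 1)"

text \<open>A total function through an arbitrarily chosen representative; \<open>ev_cls\<close>
  shows independence of the choice for \<open>admissible\<close> substitutions.\<close>

definition ev :: "('v \<Rightarrow> 'c::comm_ring_1) \<Rightarrow> ('v monomial \<Rightarrow>\<^sub>0 int) set set \<Rightarrow> 'c" where
  "ev \<theta> z = int_poly_eval \<theta> (SOME f. f \<in> carrier Z \<and> cls f = z)"

definition admissible :: "('v \<Rightarrow> 'c::comm_ring_1) \<Rightarrow> bool" where
  "admissible \<theta> \<longleftrightarrow> respects_complex V K \<theta> \<and> of_nat p = (0 :: 'c)"

lemma single_carrier: "Poly_Mapping.keys m \<subseteq> V \<Longrightarrow> Poly_Mapping.single m c \<in> carrier Z"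
  by simp

lemma mon_carrier: "Poly_Mapping.keys m \<subseteq> V \<Longrightarrow> mon m \<in> carrier Q"
  unfolding mon_def by (rule cls.hom_closed[OF single_carrier])

lemma gen_carrier: "v \<in> V \<Longrightarrow> gen v \<in> carrier Q"
  unfolding gen_def by (rule mon_carrier) simp

lemma mon_add:
  assumes "Poly_Mapping.keys m \<subseteq> V" "Poly_Mapping.keys n \<subseteq> V"
  shows "mon (m + n) = mon m \<otimes>\<^bsub>Q\<^esub> mon n"
  unfolding mon_def cls.hom_mult[OF single_carrier[OF assms(1)] single_carrier[OF assms(2)], symmetric]
  by (simp add: mult_single)

lemma mon_0: "mon 0 = \<one>\<^bsub>Q\<^esub>"
  using cls.hom_one by (simp add: mon_def)

lemma mon_grade:
  assumes "Poly_Mapping.keys m \<subseteq> V"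
  shows "mon m \<in> grade Q (monomial_degree \<phi> m)"
  unfolding mon_def grade_tensor_Zmod_SR[OF finite_V]
  by (rule imageI) (use assms in \<open>simp add: int_poly_ring_def\<close>)

lemma gen_grade: "v \<in> V \<Longrightarrow> gen v \<in> grade Q (\<phi> v)"
  using mon_grade[of "Poly_Mapping.single v 1"] by (simp add: gen_def)

lemma grade_carrier: "z \<in> grade Q d \<Longrightarrow> z \<in> carrier Q"
  unfolding grade_tensor_Zmod_SR[OF finite_V] carrier_tensor_Zmod_SR[OF finite_V]
  by (auto simp: int_poly_ring_def)

lemma ev_cls:
  assumes "admissible \<theta>" "f \<in> carrier Z"
  shows "ev \<theta> (cls f) = int_poly_eval \<theta> f"
proof -
  let ?g = "SOME g. g \<in> carrier Z \<and> cls g = cls f"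
  have "?g \<in> carrier Z \<and> cls ?g = cls f" by (rule someI) (use assms in blast)
  then show ?thesis
    unfolding ev_def using sr_mod_class_eqD[OF finite_V _ _ assms(2)] assms(1)
    unfolding admissible_def by blast
qed

lemma carrierE:
  assumes "z \<in> carrier Q" obtains f where "f \<in> carrier Z" "z = cls f"
  using assms unfolding carrier_tensor_Zmod_SR[OF finite_V] by blast

lemma ev_add:
  assumes "admissible \<theta>" "x \<in> carrier Q" "y \<in> carrier Q"
  shows "ev \<theta> (x \<oplus>\<^bsub>Q\<^esub> y) = ev \<theta> x + ev \<theta> y"
proof -
  obtain f g where f: "f \<in> carrier Z" "x = cls f" and g: "g \<in> carrier Z" "y = cls g"
    using assms(2,3) carrierE by metis
  have "x \<oplus>\<^bsub>Q\<^esub> y = cls (f \<oplus>\<^bsub>Z\<^esub> g)" unfolding f(2) g(2) cls.hom_add[OF f(1) g(1)] ..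
  then show ?thesis
    using ev_cls[OF assms(1) Z.a_closed[OF f(1) g(1)]] ev_cls[OF assms(1) f(1)] ev_cls[OF assms(1) g(1)]
    by (simp only: f(2) g(2) int_poly_ring_simps int_poly_eval_add)
qed

lemma ev_mult:
  assumes "admissible \<theta>" "x \<in> carrier Q" "y \<in> carrier Q"
  shows "ev \<theta> (x \<otimes>\<^bsub>Q\<^esub> y) = ev \<theta> x * ev \<theta> y"
proof -
  obtain f g where f: "f \<in> carrier Z" "x = cls f" and g: "g \<in> carrier Z" "y = cls g"
    using assms(2,3) carrierE by metis
  have "x \<otimes>\<^bsub>Q\<^esub> y = cls (f \<otimes>\<^bsub>Z\<^esub> g)" unfolding f(2) g(2) cls.hom_mult[OF f(1) g(1)] ..
  then show ?thesis
    using ev_cls[OF assms(1) Z.m_closed[OF f(1) g(1)]] ev_cls[OF assms(1) f(1)] ev_cls[OF assms(1) g(1)]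
    by (simp only: f(2) g(2) int_poly_ring_simps int_poly_eval_mult)
qed

lemma ev_zero: "admissible \<theta> \<Longrightarrow> ev \<theta> \<zero>\<^bsub>Q\<^esub> = 0"
  using ev_add[of \<theta> "\<zero>\<^bsub>Q\<^esub>" "\<zero>\<^bsub>Q\<^esub>"] Q.l_zero[OF Q.zero_closed] by simp

lemma ev_mon: "\<lbrakk>admissible \<theta>; Poly_Mapping.keys m \<subseteq> V\<rbrakk> \<Longrightarrow> ev \<theta> (mon m) = monomial_eval \<theta> m"
  unfolding mon_def using ev_cls[OF _ single_carrier[of m 1]] by (simp only: int_poly_eval_single) simp

lemma ev_gen: "\<lbrakk>admissible \<theta>; v \<in> V\<rbrakk> \<Longrightarrow> ev \<theta> (gen v) = \<theta> v"
  unfolding gen_def using ev_mon[of \<theta> "Poly_Mapping.single v 1"] by simp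

lemma ev_one: "admissible \<theta> \<Longrightarrow> ev \<theta> \<one>\<^bsub>Q\<^esub> = 1"
  using ev_mon[of \<theta> 0] by (simp add: mon_0)

lemma ev_pow: "\<lbrakk>admissible \<theta>; x \<in> carrier Q\<rbrakk> \<Longrightarrow> ev \<theta> (x [^]\<^bsub>Q\<^esub> (n::nat)) = ev \<theta> x ^ n"
  by (induction n) (simp_all add: ev_one ev_mult Q.nat_pow_closed mult.commute)

section \<open>Additive functionals and the Adem and Cartan formulas\<close>

definition additive_map :: "(('v monomial \<Rightarrow>\<^sub>0 int) set set \<Rightarrow> 'c::ab_group_add) \<Rightarrow> bool" where
  "additive_map \<psi> \<longleftrightarrow> (\<forall>x\<in>carrier Q. \<forall>y\<in>carrier Q. \<psi> (x \<oplus>\<^bsub>Q\<^esub> y) = \<psi> x + \<psi> y)"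

lemma additive_mapD: "\<lbrakk>additive_map \<psi>; x \<in> carrier Q; y \<in> carrier Q\<rbrakk> \<Longrightarrow> \<psi> (x \<oplus>\<^bsub>Q\<^esub> y) = \<psi> x + \<psi> y"
  by (simp only: additive_map_def)

lemma additive_map_ev: "admissible \<theta> \<Longrightarrow> additive_map (ev \<theta>)"
  by (simp add: additive_map_def ev_add)

lemma additive_map_P: "additive_map \<psi> \<Longrightarrow> additive_map (\<lambda>x. \<psi> (P a x))"
  by (simp add: additive_map_def additive closed)

lemma additive_map_zero: "additive_map \<psi> \<Longrightarrow> \<psi> \<zero>\<^bsub>Q\<^esub> = 0"
  using additive_mapD[of \<psi> "\<zero>\<^bsub>Q\<^esub>" "\<zero>\<^bsub>Q\<^esub>"] Q.l_zero[OF Q.zero_closed] by simp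

lemma additive_map_int_mult:
  fixes \<psi> :: "_ \<Rightarrow> 'c::comm_ring_1"
  assumes \<psi>: "additive_map \<psi>" and x: "x \<in> carrier Q"
  shows "\<psi> ([(n::int)] \<cdot>\<^bsub>Q\<^esub> x) = of_int n * \<psi> x"
proof -
  have neg: "\<psi> (\<ominus>\<^bsub>Q\<^esub> z) = - \<psi> z" if "z \<in> carrier Q" for z
    using additive_mapD[OF \<psi> that Q.a_inv_closed[OF that]] Q.r_neg[OF that] additive_map_zero[OF \<psi>]
    by (simp add: eq_neg_iff_add_eq_0 add.commute)
  have nat: "\<psi> ([k] \<cdot>\<^bsub>Q\<^esub> x) = of_nat k * \<psi> x" for k :: nat
    by (induction k)
      (simp_all add: x additive_map_zero[OF \<psi>] additive_mapD[OF \<psi>] Q.add.nat_pow_closed Q.add.nat_pow_Suc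
        algebra_simps)
  show ?thesis
  proof (cases "n < 0")
    case False
    then have "[n] \<cdot>\<^bsub>Q\<^esub> x = [nat n] \<cdot>\<^bsub>Q\<^esub> x"
      unfolding add_pow_def int_pow_def2 by (simp only: if_False)
    then show ?thesis using nat[of "nat n"] False by (simp only: of_nat_nat not_less)
  next
    case True
    then have "[n] \<cdot>\<^bsub>Q\<^esub> x = \<ominus>\<^bsub>Q\<^esub> ([nat (- n)] \<cdot>\<^bsub>Q\<^esub> x)"
      unfolding add_pow_def int_pow_def2 a_inv_def by (simp only: if_True)
    moreover have "of_nat (nat (- n)) = - (of_int n :: 'c)"
      using True by (metis minus_minus of_int_minus of_nat_nat neg_le_0_iff_le order_less_imp_le of_int_of_nat_eq)
    ultimately show ?thesis
      using nat[of "nat (- n)"] neg[OF Q.add.nat_pow_closed[OF x]]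
      by (simp only: mult_minus_left minus_minus)
  qed
qed

lemma additive_map_finsum:
  assumes \<psi>: "additive_map \<psi>" and "finite A" "\<And>i. i \<in> A \<Longrightarrow> f i \<in> carrier Q"
  shows "\<psi> (finsum Q f A) = (\<Sum>i\<in>A. \<psi> (f i))"
  using assms(2,3)
proof (induction A rule: finite_induct)
  case empty
  then show ?case using additive_map_zero[OF \<psi>] by simp
next
  case (insert a A)
  then have f: "f \<in> A \<rightarrow> carrier Q" "f a \<in> carrier Q" by auto
  have "finsum Q f (insert a A) = f a \<oplus>\<^bsub>Q\<^esub> finsum Q f A"
    by (rule Q.finsum_insert) (use insert f in auto)
  with insert f show ?case
    using additive_mapD[OF \<psi> f(2) Q.finsum_closed[OF f(1)]] by simp
qed

text \<open>Once a functional is applied, the Adem coefficients are scalars of \<open>'c\<close> and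
  can be reduced modulo p there, so no relation has to be manipulated among cosets.\<close>

lemma additive_map_Adem:
  fixes \<psi> :: "_ \<Rightarrow> 'c::comm_ring_1"
  assumes \<psi>: "additive_map \<psi>" and "0 < a" "a < p * b" and x: "x \<in> carrier Q"
  shows "\<psi> (P a (P b x)) = (\<Sum>j\<in>{0..a div p}.
    of_int ((-1) ^ (a + j) * int (((p - 1) * (b - j) - 1) choose (a - p * j))) * \<psi> (P (a + b - j) (P j x)))"
  unfolding Adem[OF assms(2-4)]
  using additive_map_int_mult[OF \<psi> closed[OF closed[OF x]]] Q.add.int_pow_closed[OF closed[OF closed[OF x]]]
  by (subst additive_map_finsum[OF \<psi>]) (simp_all only: finite_atLeastAtMost)

lemma ev_P_mult:
  assumes "admissible \<theta>" "x \<in> carrier Q" "y \<in> carrier Q"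
  shows "ev \<theta> (P a (x \<otimes>\<^bsub>Q\<^esub> y)) = (\<Sum>i\<le>a. ev \<theta> (P i x) * ev \<theta> (P (a - i) y))"
  unfolding Cartan[OF assms(2,3)]
  by (subst additive_map_finsum[OF additive_map_ev[OF assms(1)]])
    (use assms in \<open>simp_all only: finite_atMost finite_atLeastAtMost Q.m_closed closed ev_mult atLeast0AtMost\<close>)

lemma ev_PP_mult:
  assumes "admissible \<theta>" "x \<in> carrier Q" "y \<in> carrier Q"
  shows "ev \<theta> (P a (P b (x \<otimes>\<^bsub>Q\<^esub> y)))
    = (\<Sum>k\<le>b. \<Sum>i\<le>a. ev \<theta> (P i (P k x)) * ev \<theta> (P (a - i) (P (b - k) y)))"
proof -
  have c: "P k x \<otimes>\<^bsub>Q\<^esub> P (b - k) y \<in> carrier Q" for k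
    using assms closed by (intro Q.m_closed)
  have "ev \<theta> (P a (P b (x \<otimes>\<^bsub>Q\<^esub> y))) = (\<Sum>k\<in>{0..b}. ev \<theta> (P a (P k x \<otimes>\<^bsub>Q\<^esub> P (b - k) y)))"
    unfolding Cartan[OF assms(2,3)]
    by (rule additive_map_finsum[OF additive_map_P[OF additive_map_ev[OF assms(1)]]]) (simp_all only: c finite_atLeastAtMost)
  also have "\<dots> = (\<Sum>k\<le>b. \<Sum>i\<le>a. ev \<theta> (P i (P k x)) * ev \<theta> (P (a - i) (P (b - k) y)))"
    using ev_P_mult[OF assms(1) closed[OF assms(2)] closed[OF assms(3)]] by (simp add: atLeast0AtMost)
  finally show ?thesis .
qed

lemma additive_zero_carrier:
  fixes \<psi> :: "_ \<Rightarrow> 'c::ab_group_add"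
  assumes \<psi>: "additive_map \<psi>"
    and S: "\<And>m. m \<in> S \<Longrightarrow> Poly_Mapping.keys m \<subseteq> V" "\<And>m. m \<in> S \<Longrightarrow> \<psi> (mon m) = 0"
    and f: "Poly_Mapping.keys f \<subseteq> S"
  shows "\<psi> (cls f) = 0"
proof -
  have "f \<in> carrier Z \<and> \<psi> (cls f) = 0"
    using f
  proof (induction f rule: frag_induction)
    case zero
    have "cls 0 = \<zero>\<^bsub>Q\<^esub>" using cls.hom_zero by simp
    then show ?case using additive_map_zero[OF \<psi>] by simp
  next
    case (one m)
    then show ?case using S[of m] by (simp add: mon_def)
  next
    case (diff f g)
    have mem: "f - g \<in> carrier Z"
      using diff keys_diff[of f g] by auto
    have "\<psi> (cls ((f - g) \<oplus>\<^bsub>Z\<^esub> g)) = \<psi> (cls (f - g)) + \<psi> (cls g)"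
      using diff mem cls.hom_add[OF mem, of g] additive_mapD[OF \<psi> cls.hom_closed[OF mem], of "cls g"] cls.hom_closed by metis
    then show ?case using diff mem by simp
  qed
  then show ?thesis ..
qed

lemma additive_zero:
  fixes \<psi> :: "_ \<Rightarrow> 'c::ab_group_add"
  assumes "additive_map \<psi>"
    and "\<And>m. Poly_Mapping.keys m \<subseteq> V \<Longrightarrow> \<psi> (mon m) = 0"
    and "z \<in> carrier Q"
  shows "\<psi> z = 0"
proof -
  obtain f where "f \<in> carrier Z" "z = cls f" using assms(3) by (rule carrierE)
  then show ?thesis
    using additive_zero_carrier[of \<psi> "{m. Poly_Mapping.keys m \<subseteq> V}" f] assms(1,2) by auto
qed

text \<open>An element of degree d has a representative all of whose monomials have degree d. Every
  vanishing for degree reasons below comes through this fact.\<close>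

lemma additive_zero_grade:
  fixes \<psi> :: "_ \<Rightarrow> 'c::ab_group_add"
  assumes "additive_map \<psi>"
    and "\<And>m. \<lbrakk>Poly_Mapping.keys m \<subseteq> V; monomial_degree \<phi> m = d\<rbrakk> \<Longrightarrow> \<psi> (mon m) = 0"
    and "z \<in> grade Q d"
  shows "\<psi> z = 0"
proof -
  obtain f where "f \<in> grade Z d" "z = cls f"
    using assms(3) unfolding grade_tensor_Zmod_SR[OF finite_V] by blast
  then show ?thesis
    using additive_zero_carrier[of \<psi> "{m. Poly_Mapping.keys m \<subseteq> V \<and> monomial_degree \<phi> m = d}" f] assms(1,2)
    by (auto simp: int_poly_ring_def)
qed

text \<open>The Leibniz rule at the product of 1 with itself gives \<psi> 1 = 0, and multiplication
  by generators then reaches every monomial. Applied to a difference, this identifies two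
  derivations along the same \<nu> from their values on generators.\<close>

lemma derivation_zero:
  fixes \<psi> :: "_ \<Rightarrow> 'c::comm_ring_1"
  assumes "additive_map \<psi>"
    and mult: "\<And>x y. \<lbrakk>x \<in> carrier Q; y \<in> carrier Q\<rbrakk> \<Longrightarrow> \<psi> (x \<otimes>\<^bsub>Q\<^esub> y) = \<psi> x * \<nu> y + \<nu> x * \<psi> y"
    and "\<nu> \<one>\<^bsub>Q\<^esub> = 1" and "\<And>v. v \<in> V \<Longrightarrow> \<psi> (gen v) = 0" and "z \<in> carrier Q"
  shows "\<psi> z = 0"
proof (rule additive_zero[OF assms(1) _ assms(5)])
  have one: "\<psi> \<one>\<^bsub>Q\<^esub> = 0"
    using mult[OF Q.one_closed Q.one_closed] Q.l_one[OF Q.one_closed] assms(3) by simp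
  fix m :: "'v monomial" assume "Poly_Mapping.keys m \<subseteq> V"
  then show "\<psi> (mon m) = 0"
  proof (induction m rule: monomial_induct)
    case zero
    then show ?case using one by (simp add: mon_0)
  next
    case (add m v)
    then have "mon (m + Poly_Mapping.single v 1) = mon m \<otimes>\<^bsub>Q\<^esub> gen v"
      using mon_add[of m "Poly_Mapping.single v 1"] by (simp add: gen_def)
    then show ?case using mult[OF mon_carrier gen_carrier] add assms(4) by simp
  qed
qed

end

section \<open>Binomial coefficients modulo p and linear terms of products\<close>

lemma of_int_cong_char:
  assumes "of_nat p = (0 :: 'c::comm_ring_1)" "int p dvd m - n"
  shows "of_int m = (of_int n :: 'c)"
proof -
  obtain k where "m = n + int p * k" using assms(2) by (auto simp: dvd_def algebra_simps)
  then show ?thesis using assms(1) by simp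
qed

text \<open>Since p divides the inner entries of row p of Pascal's triangle, neighboring entries of
  row p - 1 are negatives of each other modulo p.\<close>

lemma prime_dvd_choose_pred:
  assumes "prime p" "k < p"
  shows "int p dvd int ((p - 1) choose k) - (-1) ^ k"
  using assms(2)
proof (induction k)
  case 0
  then show ?case by simp
next
  case (Suc k)
  have "p dvd p choose Suc k"
    using Suc.prems assms(1) by (intro dvd_choose_prime) auto
  moreover have "p choose Suc k = ((p - 1) choose k) + ((p - 1) choose Suc k)"
    using prime_gt_0_nat[OF assms(1)] by (cases p) simp_all
  ultimately have "int p dvd int ((p - 1) choose k) + int ((p - 1) choose Suc k)"
    by (metis int_dvd_int_iff of_nat_add)
  moreover have "int p dvd int ((p - 1) choose k) - (-1) ^ k" using Suc by simp
  ultimately have "int p dvd (int ((p - 1) choose k) + int ((p - 1) choose Suc k)) - (int ((p - 1) choose k) - (-1) ^ k)"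
    by (rule dvd_diff)
  then show ?case by simp
qed

text \<open>Modulo p and t^p, the power (1 + t)^(p-2) equals (1 + t)^(-2), whose coefficients are
  (-1)^k (k + 1). The induction obtains them from row p - 1 by Pascal's rule.\<close>

lemma prime_dvd_choose_pred2:
  assumes "prime p" "k < p"
  shows "int p dvd (-1) ^ k * int ((p - 2) choose k) - int (k + 1)"
  using assms(2)
proof (induction k)
  case 0
  then show ?case by simp
next
  case (Suc k)
  have "p \<ge> 2" using prime_ge_2_nat[OF assms(1)] .
  then have "p - 1 = Suc (p - 2)" by simp
  then have ch: "(p - 1) choose Suc k = ((p - 2) choose k) + ((p - 2) choose Suc k)"
    by simp
  obtain u where u: "int ((p - 1) choose Suc k) - (-1) ^ Suc k = int p * u"
    using prime_dvd_choose_pred[OF assms(1) Suc.prems] by (auto simp: dvd_def)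
  obtain w where w: "(-1) ^ k * int ((p - 2) choose k) - int (k + 1) = int p * w"
    using Suc by (auto simp: dvd_def)
  have "(-1) ^ Suc k * int ((p - 2) choose Suc k)
    = (-1) ^ Suc k * int ((p - 1) choose Suc k) + (-1) ^ k * int ((p - 2) choose k)"
    unfolding ch of_nat_add by (simp add: algebra_simps)
  also have "\<dots> = (-1) ^ Suc k * (int p * u + (-1) ^ Suc k) + (int p * w + int (k + 1))"
  proof -
    have "int ((p - 1) choose Suc k) = int p * u + (-1) ^ Suc k" using u by linarith
    moreover have "(-1) ^ k * int ((p - 2) choose k) = int p * w + int (k + 1)" using w by linarith
    ultimately show ?thesis by (simp only:)
  qed
  also have "\<dots> = int p * ((-1) ^ Suc k * u + w) + (1 + int (k + 1))"
    by (simp add: algebra_simps flip: power_add)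
  finally show ?case by simp
qed

lemma coeff_1_mult: "coeff (f * g) 1 = coeff f 1 * coeff g 0 + coeff f 0 * (coeff g 1 :: 'a::comm_ring_1)"
  by (simp add: coeff_mult atMost_Suc)

lemma coeff_1_power: "coeff (f ^ n) 1 = of_nat n * coeff f 0 ^ (n - 1) * (coeff f 1 :: 'a::comm_ring_1)"
proof (induction n)
  case (Suc n)
  then show ?case
    by (cases n) (simp_all add: coeff_1_mult coeff_mult_0 coeff_0_power algebra_simps del: One_nat_def)
qed simp

section \<open>Special Adem relations and the commutator of \<open>P^p\<close> and
  \<open>P^1\<close>\<close>

context sr_steenrod
begin

lemma p_ge_3: "3 \<le> p"
  using prime_p odd_p by (metis prime_ge_2_nat even_numeral le_antisym not_less_eq_eq numeral_2_eq_2 numeral_3_eq_3)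

text \<open>As 1 div p = 0, only the term j = 0 is present, and its coefficient -((p - 1) b - 1) is
  b + 1 modulo p. For b = p this turns \<open>P^1 P^p\<close> into \<open>P^(p+1)\<close>.\<close>

lemma P_1_P:
  fixes \<psi> :: "_ \<Rightarrow> 'c::comm_ring_1"
  assumes "additive_map \<psi>" "of_nat p = (0 :: 'c)" "x \<in> carrier Q"
  shows "\<psi> (P 1 (P b x)) = of_nat (b + 1) * \<psi> (P (b + 1) x)"
proof (cases "b = 0")
  case True
  then show ?thesis using P_0[OF assms(3)] by simp
next
  case False
  have p: "1 < p" using p_ge_3 by simp
  then have pb: "1 < p * b" using False by (cases b) auto
  have "\<psi> (P 1 (P b x)) = of_int (- int ((p - 1) * b - 1)) * \<psi> (P (b + 1) x)"
    using additive_map_Adem[OF assms(1) _ _ assms(3), of 1 b] pb p P_0[OF assms(3)]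
    by (simp add: add.commute)
  also have "of_int (- int ((p - 1) * b - 1)) = (of_int (int (b + 1)) :: 'c)"
  proof (rule of_int_cong_char[OF assms(2)])
    have "1 \<le> (p - 1) * b" using False p by simp
    then have "int ((p - 1) * b - 1) = (int p - 1) * int b - 1"
      using p by (simp add: of_nat_diff)
    then have "- int ((p - 1) * b - 1) - int (b + 1) = int p * (- int b)"
      by (simp add: algebra_simps)
    then show "int p dvd - int ((p - 1) * b - 1) - int (b + 1)" by simp
  qed
  finally show ?thesis by simp
qed

text \<open>Again only j = 0 occurs, now with coefficient (-1)^a binomial(p - 2, a). The result has
  the same form as \<open>P_1_P\<close>, whence the commutation for a < p.\<close>

lemma P_P_1:
  fixes \<psi> :: "_ \<Rightarrow> 'c::comm_ring_1"
  assumes "additive_map \<psi>" "of_nat p = (0 :: 'c)" "x \<in> carrier Q" "a < p"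
  shows "\<psi> (P a (P 1 x)) = of_nat (a + 1) * \<psi> (P (a + 1) x)"
proof (cases "a = 0")
  case True
  then show ?thesis using P_0[OF closed[OF assms(3)]] by simp
next
  case False
  have "\<psi> (P a (P 1 x)) = of_int ((-1) ^ a * int ((p - 2) choose a)) * \<psi> (P (a + 1) x)"
    using additive_map_Adem[OF assms(1) _ _ assms(3), of a 1] False assms(4) P_0[OF assms(3)]
    by (simp add: numeral_2_eq_2)
  also have "of_int ((-1) ^ a * int ((p - 2) choose a)) = (of_int (int (a + 1)) :: 'c)"
    by (rule of_int_cong_char[OF assms(2) prime_dvd_choose_pred2[OF prime_p assms(4)]])
  finally show ?thesis by simp
qed

text \<open>Here j is 0 or 1: the first term contains \<open>P^(2p) x\<close>, the second has
  coefficient (-1)^(p+1) = 1 because p is odd.\<close>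

lemma P_p_P_p:
  assumes "additive_map \<psi>" "of_nat p = (0 :: 'c::comm_ring_1)" "x \<in> carrier Q" "P (2 * p) x = \<zero>\<^bsub>Q\<^esub>"
  shows "\<psi> (P p (P p x)) = (\<psi> (P (2 * p - 1) (P 1 x)) :: 'c)"
proof -
  have "0 < p" "p < p * p" "p div p = 1" "even (p + 1)" using p_ge_3 odd_p by auto
  then show ?thesis
    using additive_map_Adem[OF assms(1) _ _ assms(3), of p p] P_0[OF assms(3)] assms(4) additive_map_zero[OF assms(1)]
    by (simp add: mult_2)
qed

text \<open>The commutator of \<open>P\<^sup>p\<close> and \<open>P\<^sup>1\<close> is a derivation (Milnor's primitive element of degree
  \<open>2 (p\<^sup>2 - 1)\<close>), because \<open>P\<^sup>a\<close> and \<open>P\<^sup>1\<close> commute for \<open>a < p\<close>.\<close>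

definition ev_comm :: "('v \<Rightarrow> 'c::comm_ring_1) \<Rightarrow> ('v monomial \<Rightarrow>\<^sub>0 int) set set \<Rightarrow> 'c" where
  "ev_comm \<theta> x = ev \<theta> (P p (P 1 x)) - ev \<theta> (P 1 (P p x))"

lemma additive_map_ev_comm: "admissible \<theta> \<Longrightarrow> additive_map (ev_comm \<theta>)"
  using additive_mapD[OF additive_map_P[OF additive_map_P[OF additive_map_ev]], of \<theta>]
  by (simp add: additive_map_def ev_comm_def)

lemma ev_comm_mult:
  fixes \<theta> :: "'v \<Rightarrow> 'c::comm_ring_1"
  assumes \<theta>: "admissible \<theta>" and x: "x \<in> carrier Q" and y: "y \<in> carrier Q"
  shows "ev_comm \<theta> (x \<otimes>\<^bsub>Q\<^esub> y) = ev_comm \<theta> x * ev \<theta> y + ev \<theta> x * ev_comm \<theta> y"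
proof -
  have p0: "of_nat p = (0 :: 'c)" using \<theta> by (simp add: admissible_def)
  \<comment> \<open>The defect of commutation for every index i. After Cartan expansion each term
    carries one such defect, and only the index p can contribute.\<close>
  define c where "c = (\<lambda>i z. ev \<theta> (P i (P 1 z)) - ev \<theta> (P 1 (P i z)))"
  have c0: "c i z = 0" if "i < p" "z \<in> carrier Q" for i z
    using P_1_P[OF additive_map_ev[OF \<theta>] p0 that(2), of i] P_P_1[OF additive_map_ev[OF \<theta>] p0 that(2,1)]
    by (simp add: c_def)
  have cp: "c p z = ev_comm \<theta> z" for z by (simp add: c_def ev_comm_def)
  have P0: "P 0 z = z" if "z \<in> carrier Q" for z by (rule P_0[OF that])
  have e1: "ev \<theta> (P p (P 1 (x \<otimes>\<^bsub>Q\<^esub> y)))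
    = (\<Sum>i\<le>p. ev \<theta> (P i x) * ev \<theta> (P (p - i) (P 1 y)) + ev \<theta> (P i (P 1 x)) * ev \<theta> (P (p - i) y))"
    unfolding ev_PP_mult[OF \<theta> x y] using P0 x y by (simp add: atMost_Suc sum.distrib)
  have e2: "ev \<theta> (P 1 (P p (x \<otimes>\<^bsub>Q\<^esub> y)))
    = (\<Sum>i\<le>p. ev \<theta> (P i x) * ev \<theta> (P 1 (P (p - i) y)) + ev \<theta> (P 1 (P i x)) * ev \<theta> (P (p - i) y))"
    unfolding ev_PP_mult[OF \<theta> x y] using P0 closed x y by (simp add: atMost_Suc)
  have "ev_comm \<theta> (x \<otimes>\<^bsub>Q\<^esub> y) = (\<Sum>i\<le>p. ev \<theta> (P i x) * c (p - i) y + c i x * ev \<theta> (P (p - i) y))"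
    unfolding ev_comm_def e1 e2 c_def sum_subtractf[symmetric]
    by (intro sum.cong refl) (simp add: algebra_simps)
  also have "\<dots> = (\<Sum>i\<le>p. ev \<theta> (P i x) * c (p - i) y) + (\<Sum>i\<le>p. c i x * ev \<theta> (P (p - i) y))"
    by (simp add: sum.distrib)
  also have "(\<Sum>i\<le>p. ev \<theta> (P i x) * c (p - i) y) = (\<Sum>i\<in>{0}. ev \<theta> (P i x) * c (p - i) y)"
    by (rule sum.mono_neutral_right) (use c0[OF _ y] in auto)
  also have "(\<Sum>i\<le>p. c i x * ev \<theta> (P (p - i) y)) = (\<Sum>i\<in>{p}. c i x * ev \<theta> (P (p - i) y))"
    by (rule sum.mono_neutral_right) (use c0[OF _ x] in auto)
  finally show ?thesis using P0 x y by (simp add: cp)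
qed

text \<open>For \<open>y\<close> the product of the generators of an edge, this replaces the invariance of the
  minimal prime ideal of that edge.\<close>

lemma ev_PP_annihilator:
  fixes \<theta> :: "'v \<Rightarrow> 'c::idom"
  assumes \<theta>: "admissible \<theta>" and x: "x \<in> carrier Q" and y: "y \<in> carrier Q"
    and xy: "x \<otimes>\<^bsub>Q\<^esub> y = \<zero>\<^bsub>Q\<^esub>" and ne: "ev \<theta> y \<noteq> 0"
  shows "ev \<theta> (P a (P b x)) = 0"
proof (induction "a + b" arbitrary: a b rule: less_induct)
  case less
  have "(\<Sum>k\<le>b. \<Sum>i\<le>a. ev \<theta> (P i (P k x)) * ev \<theta> (P (a - i) (P (b - k) y))) = 0"
    unfolding ev_PP_mult[OF \<theta> x y, symmetric] xy
    using additive_map_zero[OF additive_map_P[OF additive_map_P[OF additive_map_ev[OF \<theta>]]]] .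
  \<comment> \<open>Every other term applies to x a composite of smaller total index and vanishes by
    induction. What survives is the wanted value times the nonzero value of y, in a domain.\<close>
  moreover have "(\<Sum>k\<le>b. \<Sum>i\<le>a. ev \<theta> (P i (P k x)) * ev \<theta> (P (a - i) (P (b - k) y)))
    = (\<Sum>k\<le>b. \<Sum>i\<le>a. if k = b \<and> i = a then ev \<theta> (P a (P b x)) * ev \<theta> y else 0)"
    by (intro sum.cong refl) (use less P_0 y in \<open>auto simp: not_less\<close>)
  moreover have "\<dots> = (\<Sum>k\<le>b. if k = b then ev \<theta> (P a (P b x)) * ev \<theta> y else 0)"
    by (intro sum.cong refl) auto
  ultimately show ?case using ne by simp
qed

lemma ev_P_annihilator:
  fixes \<theta> :: "'v \<Rightarrow> 'c::idom"
  assumes "admissible \<theta>" "x \<in> carrier Q" "y \<in> carrier Q" "x \<otimes>\<^bsub>Q\<^esub> y = \<zero>\<^bsub>Q\<^esub>" "ev \<theta> y \<noteq> 0"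
  shows "ev \<theta> (P a x) = 0"
  using ev_PP_annihilator[OF assms, of a 0] P_0[OF assms(2)] by simp

text \<open>By the Cartan formula the generating series of the \<open>P^a\<close> is multiplicative.
  Its constant part \<open>F\<close> is multiplicative and its linear part \<open>H\<close> is a
  derivation along \<open>F\<close>, so on a pth power \<open>H\<close> takes the value p F^(p-1) H
  = 0.\<close>

lemma coeff_1_ev_P_pow:
  fixes \<theta> :: "'v \<Rightarrow> 'c::comm_ring_1 poly"
  assumes \<theta>: "admissible \<theta>" and x: "x \<in> carrier Q"
  shows "coeff (ev \<theta> (P a (x [^]\<^bsub>Q\<^esub> p))) 1 = 0"
proof -
  define F H :: "('v monomial \<Rightarrow>\<^sub>0 int) set set \<Rightarrow> 'c fps"
    where "F = (\<lambda>z. Abs_fps (\<lambda>a. coeff (ev \<theta> (P a z)) 0))"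
      and "H = (\<lambda>z. Abs_fps (\<lambda>a. coeff (ev \<theta> (P a z)) 1))"
  have mult: "F (y \<otimes>\<^bsub>Q\<^esub> z) = F y * F z" "H (y \<otimes>\<^bsub>Q\<^esub> z) = H y * F z + F y * H z"
    if "y \<in> carrier Q" "z \<in> carrier Q" for y z
    by (rule fps_ext; simp add: F_def H_def fps_mult_nth ev_P_mult[OF \<theta> that] coeff_sum coeff_mult_0
        coeff_1_mult sum.distrib atLeast0AtMost del: One_nat_def)+
  have one: "F \<one>\<^bsub>Q\<^esub> = 1" "H \<one>\<^bsub>Q\<^esub> = 0"
  proof -
    have "\<one>\<^bsub>Q\<^esub> \<in> grade Q 0" using mon_grade[of 0] by (simp add: mon_0)
    then have "P a \<one>\<^bsub>Q\<^esub> = (if a = 0 then \<one>\<^bsub>Q\<^esub> else \<zero>\<^bsub>Q\<^esub>)" for a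
      using unstable[of "\<one>\<^bsub>Q\<^esub>" 0 a] P_0[OF Q.one_closed] by simp
    then show "F \<one>\<^bsub>Q\<^esub> = 1" "H \<one>\<^bsub>Q\<^esub> = 0"
      using ev_one[OF \<theta>] ev_zero[OF \<theta>] by (auto simp: F_def H_def fps_eq_iff)
  qed
  have "F (x [^]\<^bsub>Q\<^esub> n) = F x ^ n \<and> H (x [^]\<^bsub>Q\<^esub> n) = of_nat n * F x ^ (n - 1) * H x" for n :: nat
  proof (induction n)
    case 0
    then show ?case using one by simp
  next
    case (Suc n)
    then show ?case
      using mult[OF Q.nat_pow_closed[OF x, of n] x] by (cases n) (simp_all add: algebra_simps)
  qed
  moreover have "of_nat p = (0 :: 'c fps)"
    using \<theta> by (simp add: admissible_def of_nat_poly fps_of_nat[symmetric])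
  ultimately have "H (x [^]\<^bsub>Q\<^esub> p) = 0" by simp
  then have "fps_nth (H (x [^]\<^bsub>Q\<^esub> p)) a = 0" by simp
  then show ?thesis by (simp add: H_def)
qed

text \<open>The condition a + b = n + 1 is tight: each Cartan term vanishes by instability or
  contains \<open>P^a x = x^p\<close> or \<open>P^b y = y^p\<close>. A pth power of something
  without constant term has neither constant nor linear term.\<close>

lemma coeff_1_ev_P_decomposable:
  fixes \<theta> :: "'v \<Rightarrow> 'c::comm_ring_1 poly"
  assumes \<theta>: "admissible \<theta>" and x: "x \<in> grade Q (2 * a)" and y: "y \<in> grade Q (2 * b)"
    and ab: "a + b = n + 1" and x0: "coeff (ev \<theta> x) 0 = 0" and y0: "coeff (ev \<theta> y) 0 = 0"
  shows "coeff (ev \<theta> (P n (x \<otimes>\<^bsub>Q\<^esub> y))) 1 = 0"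
proof -
  have xc: "x \<in> carrier Q" and yc: "y \<in> carrier Q" using x y grade_carrier by auto
  have p0: "of_nat p = (0 :: 'c)" using \<theta> by (simp add: admissible_def of_nat_poly)
  have pow: "coeff (ev \<theta> (z [^]\<^bsub>Q\<^esub> p)) 1 = 0" "coeff (ev \<theta> (z [^]\<^bsub>Q\<^esub> p)) 0 = 0"
    if "z \<in> carrier Q" "coeff (ev \<theta> z) 0 = 0" for z
    using that p0 p_ge_3
    by (simp_all add: ev_pow[OF \<theta>] coeff_1_power coeff_0_power power_0_left del: One_nat_def)
  have "coeff (ev \<theta> (P i x) * ev \<theta> (P (n - i) y)) 1 = 0" if "i \<le> n" for i
  proof -
    consider "a < i" | "b < n - i" | "i = a" | "n - i = b" using ab that by linarith
    then show ?thesis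
    proof cases
      case 1
      then have "P i x = \<zero>\<^bsub>Q\<^esub>" using unstable[OF x] by simp
      then show ?thesis using ev_zero[OF \<theta>] by simp
    next
      case 2
      then have "P (n - i) y = \<zero>\<^bsub>Q\<^esub>" using unstable[OF y] by simp
      then show ?thesis using ev_zero[OF \<theta>] by simp
    next
      case 3
      then show ?thesis using power[OF x] pow[OF xc x0] by (simp add: coeff_1_mult del: One_nat_def)
    next
      case 4
      then show ?thesis using power[OF y] pow[OF yc y0] by (simp add: coeff_1_mult del: One_nat_def)
    qed
  qed
  then show ?thesis
    unfolding ev_P_mult[OF \<theta> xc yc] by (simp add: coeff_sum del: One_nat_def)
qed

end

section \<open>The rings attached to a graph\<close>

lemma simplicial_join_Pow:
  "simplicial_join (Pow A) {\<sigma> \<union> \<tau> | \<sigma> \<tau>. \<sigma> \<subseteq> C \<and> \<tau> \<in> B} = {\<sigma> \<union> \<tau> | \<sigma> \<tau>. \<sigma> \<subseteq> A \<union> C \<and> \<tau> \<in> B}"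
    (is "?L = ?R")
proof
  show "?L \<subseteq> ?R"
  proof
    fix x assume "x \<in> ?L"
    then obtain \<alpha> \<sigma> \<tau> where *: "x = \<alpha> \<union> (\<sigma> \<union> \<tau>)" "\<alpha> \<subseteq> A" "\<sigma> \<subseteq> C" "\<tau> \<in> B"
      unfolding simplicial_join_def by blast
    then have "x = (\<alpha> \<union> \<sigma>) \<union> \<tau> \<and> \<alpha> \<union> \<sigma> \<subseteq> A \<union> C \<and> \<tau> \<in> B" by blast
    then show "x \<in> ?R" by blast
  qed
  show "?R \<subseteq> ?L"
  proof
    fix x assume "x \<in> ?R"
    then obtain \<sigma> \<tau> where *: "x = \<sigma> \<union> \<tau>" "\<sigma> \<subseteq> A \<union> C" "\<tau> \<in> B" by blast
    then have "x = (\<sigma> \<inter> A) \<union> ((\<sigma> \<inter> C) \<union> \<tau>)" by blast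
    moreover have "\<sigma> \<inter> A \<in> Pow A" "(\<sigma> \<inter> C) \<union> \<tau> \<in> {\<sigma> \<union> \<tau> | \<sigma> \<tau>. \<sigma> \<subseteq> C \<and> \<tau> \<in> B}"
      using * by blast+
    ultimately show "x \<in> ?L" unfolding simplicial_join_def by blast
  qed
qed

lemma foldr_simplicial_join_Pow:
  "foldr simplicial_join (map (\<lambda>k. Pow (S k)) ks) B = {\<sigma> \<union> \<tau> | \<sigma> \<tau>. \<sigma> \<subseteq> (\<Union>k\<in>set ks. S k) \<and> \<tau> \<in> B}"
  by (induction ks) (simp_all add: simplicial_join_Pow)

text \<open>Full simplices impose no condition in a join, so only the graph part of a set
  decides.\<close>

lemma A_complex_iff:
  assumes "\<sigma> \<subseteq> A_vertices p s G"
  shows "\<sigma> \<in> A_complex p s G \<longleftrightarrow> {t. Y t \<in> \<sigma>} \<in> graph_complex G"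
proof -
  let ?S = "\<Union>k\<in>{1..p - 1}. simplex_vertices s k"
  have S: "(\<Union>k\<in>set [1..<p]. simplex_vertices s k) = ?S" by (rule arg_cong[where f = "\<lambda>A. \<Union>k\<in>A. simplex_vertices s k"]) auto
  have Y: "Y t \<notin> ?S" for t by (auto simp: simplex_vertices_def)
  have eq: "A_complex p s G = {\<rho> \<union> \<tau> | \<rho> \<tau>. \<rho> \<subseteq> ?S \<and> \<tau> \<in> (`) Y ` graph_complex G}"
    unfolding A_complex_def foldr_simplicial_join_Pow S ..
  show ?thesis
  proof
    assume "\<sigma> \<in> A_complex p s G"
    then obtain \<rho> \<tau>' where \<sigma>: "\<sigma> = \<rho> \<union> \<tau>'" "\<rho> \<subseteq> ?S" "\<tau>' \<in> (`) Y ` graph_complex G"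
      unfolding eq by (elim CollectE exE conjE)
    from \<sigma>(3) obtain \<tau> where \<tau>: "\<tau>' = Y ` \<tau>" "\<tau> \<in> graph_complex G" by (rule imageE)
    have "{t. Y t \<in> \<sigma>} = \<tau>"
    proof (rule Set.set_eqI)
      fix t
      have "Y t \<notin> \<rho>" using Y[of t] \<sigma>(2) by (rule contra_subsetD[rotated])
      then show "t \<in> {t. Y t \<in> \<sigma>} \<longleftrightarrow> t \<in> \<tau>" unfolding \<sigma>(1) \<tau>(1) by auto
    qed
    then show "{t. Y t \<in> \<sigma>} \<in> graph_complex G" using \<tau>(2) by (simp only:)
  next
    assume t: "{t. Y t \<in> \<sigma>} \<in> graph_complex G"
    have "\<sigma> \<subseteq> ?S \<union> range Y"
      using assms unfolding A_vertices_def by auto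
    then have "\<sigma> = (\<sigma> \<inter> ?S) \<union> Y ` {t. Y t \<in> \<sigma>}" by auto
    moreover have "\<sigma> \<inter> ?S \<subseteq> ?S" by (rule Int_lower2)
    ultimately show "\<sigma> \<in> A_complex p s G"
      unfolding eq using imageI[OF t, of "(`) Y"] by (intro CollectI exI conjI)
  qed
qed

locale graph_steenrod = pair_graph G for G :: "'v pair_pre_digraph" +
  fixes p :: nat and s :: "nat \<Rightarrow> nat"
    and P :: "nat \<Rightarrow> ('v gen monomial \<Rightarrow>\<^sub>0 int) set set \<Rightarrow> ('v gen monomial \<Rightarrow>\<^sub>0 int) set set"
  assumes steenrod_A: "steenrod_structure p (tensor_Zmod (A_ring p s G) p) P"
    and prime_p: "prime p" and odd_p: "odd p"
begin

abbreviation "V \<equiv> A_vertices p s G"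

lemma finite_V: "finite V"
  by (auto simp: A_vertices_def simplex_vertices_def)

sublocale sr_steenrod p V "A_complex p s G" "A_degree p" P
  by (rule sr_steenrod.intro[OF steenrod_A[unfolded A_ring_def] finite_V prime_p odd_p])

lemma X_in_V: "X k i \<in> V \<longleftrightarrow> 1 \<le> k \<and> k \<le> p - 1 \<and> i \<in> {1..s k}"
  by (auto simp: A_vertices_def simplex_vertices_def image_iff)

lemma Y_in_V: "Y t \<in> V \<longleftrightarrow> t \<in> pverts G"
  by (auto simp: A_vertices_def simplex_vertices_def)

lemma V_cases:
  assumes "g \<in> V"
  obtains (X1) i where "g = X 1 i" "i \<in> {1..s 1}"
    | (X) k i where "g = X k i" "2 \<le> k" "k \<le> p - 1"
    | (Y) t where "g = Y t" "t \<in> pverts G"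
proof (cases g)
  case (X k i)
  with assms show ?thesis using that(1)[of i] that(2)[of k i] by (cases "k = 1") (auto simp: X_in_V)
next
  case (Y t)
  with assms show ?thesis using that(3) by (auto simp: Y_in_V)
qed

definition graph_admissible :: "('v \<Rightarrow> 'c::comm_ring_1) \<Rightarrow> bool" where
  "graph_admissible \<eta> \<longleftrightarrow> of_nat p = (0 :: 'c) \<and>
    (\<forall>\<tau>\<subseteq>pverts G. \<tau> \<notin> graph_complex G \<longrightarrow> (\<Prod>t\<in>\<tau>. \<eta> t) = 0)"

text \<open>The graph part of a non-face is itself a non-face, and its product divides the whole
  product. The values at the \<open>X k i\<close> may therefore be chosen freely.\<close>

lemma graph_admissible_imp:
  fixes \<theta> :: "'v gen \<Rightarrow> 'd::comm_ring_1" and \<eta> :: "'v \<Rightarrow> 'd"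
  assumes "graph_admissible \<eta>" "\<And>t. \<theta> (Y t) = \<eta> t"
  shows "admissible \<theta>"
  unfolding admissible_def respects_complex_def
proof (intro conjI allI impI)
  fix \<sigma> assume \<sigma>: "\<sigma> \<subseteq> V" "\<sigma> \<notin> A_complex p s G"
  let ?\<tau> = "{t. Y t \<in> \<sigma>}"
  have "?\<tau> \<subseteq> pverts G" using \<sigma>(1) Y_in_V by blast
  moreover have "?\<tau> \<notin> graph_complex G" using A_complex_iff[OF \<sigma>(1)] \<sigma>(2) by blast
  ultimately have "(\<Prod>t\<in>?\<tau>. \<eta> t) = 0" using assms(1) by (auto simp: graph_admissible_def)
  moreover have "(\<Prod>g\<in>Y ` ?\<tau>. \<theta> g) = (\<Prod>t\<in>?\<tau>. \<eta> t)"
    by (subst prod.reindex) (auto simp: inj_on_def assms(2))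
  moreover have "(\<Prod>g\<in>\<sigma>. \<theta> g) = (\<Prod>g\<in>\<sigma> - Y ` ?\<tau>. \<theta> g) * (\<Prod>g\<in>Y ` ?\<tau>. \<theta> g)"
    by (rule prod.subset_diff) (use finite_subset[OF \<sigma>(1) finite_V] in auto)
  ultimately show "(\<Prod>g\<in>\<sigma>. \<theta> g) = 0" by simp
qed (use assms(1) in \<open>simp add: graph_admissible_def\<close>)

text \<open>All generators \<open>X k i\<close> are sent to \<open>0\<close>, except that \<open>sub1 \<eta> j\<close> keeps \<open>X 1 j\<close> as a
  polynomial variable.\<close>

definition sub0 :: "('v \<Rightarrow> 'c::comm_ring_1) \<Rightarrow> 'v gen \<Rightarrow> 'c" where
  "sub0 \<eta> g = (case g of X k i \<Rightarrow> 0 | Y t \<Rightarrow> \<eta> t)"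

definition sub1 :: "('v \<Rightarrow> 'c::comm_ring_1) \<Rightarrow> nat \<Rightarrow> 'v gen \<Rightarrow> 'c poly" where
  "sub1 \<eta> j g = (case g of X k i \<Rightarrow> if k = 1 \<and> i = j then [:0, 1:] else 0 | Y t \<Rightarrow> [:\<eta> t:])"

lemma sub_simps [simp]:
  "sub0 \<eta> (X k i) = 0" "sub0 \<eta> (Y t) = \<eta> t"
  "sub1 \<eta> j (X k i) = (if k = 1 \<and> i = j then [:0, 1:] else 0)" "sub1 \<eta> j (Y t) = [:\<eta> t:]"
  by (simp_all add: sub0_def sub1_def)

lemma admissible_sub0: "graph_admissible \<eta> \<Longrightarrow> admissible (sub0 \<eta>)"
  by (rule graph_admissible_imp) auto

lemma admissible_sub1:
  fixes \<eta> :: "'v \<Rightarrow> 'c::comm_ring_1"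
  assumes "graph_admissible \<eta>"
  shows "admissible (sub1 \<eta> j)"
proof (rule graph_admissible_imp[where \<eta> = "\<lambda>t. [:\<eta> t:]"])
  have "(\<Prod>t\<in>\<tau>. [:\<eta> t:]) = [:\<Prod>t\<in>\<tau>. \<eta> t:]" for \<tau> :: "'v set"
    by (induction \<tau> rule: infinite_finite_induct) (simp_all add: one_pCons)
  then show "graph_admissible (\<lambda>t. [:\<eta> t:])"
    using assms by (simp add: graph_admissible_def of_nat_poly)
qed simp

text \<open>Both sides evaluate the same chosen representative, so this is the corresponding fact
  for integer polynomials, at any substitution.\<close>

lemma ev_hom:
  assumes "\<And>x y. h (x - y) = h x - h y" "\<And>x y. h (x * y) = h x * h y" "h 1 = 1"
  shows "h (ev \<theta> z) = ev (\<lambda>v. h (\<theta> v)) z"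
  unfolding ev_def by (rule int_poly_eval_hom[OF assms])

lemma coeff_0_ev_sub1: "coeff (ev (sub1 \<eta> j) z) 0 = ev (sub0 \<eta>) z"
proof -
  have "coeff (ev (sub1 \<eta> j) z) 0 = ev (\<lambda>v. coeff (sub1 \<eta> j v) 0) z"
    by (rule ev_hom) (simp_all add: coeff_mult_0)
  also have "(\<lambda>v. coeff (sub1 \<eta> j v) 0) = sub0 \<eta>"
    by (rule ext) (simp add: sub0_def sub1_def split: gen.splits)
  finally show ?thesis .
qed

text \<open>The partial derivative in the direction of \<open>X 1 j\<close> at the point where all
  \<open>X k i\<close> are 0, hence a derivation along \<open>ev (sub0 \<eta>)\<close>. One such map
  for each j replaces truncation modulo products of the x_i.\<close>

definition ev1 :: "('v \<Rightarrow> 'c::comm_ring_1) \<Rightarrow> nat \<Rightarrow> ('v gen monomial \<Rightarrow>\<^sub>0 int) set set \<Rightarrow> 'c" where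
  "ev1 \<eta> j z = coeff (ev (sub1 \<eta> j) z) 1"

lemma additive_map_ev1:
  assumes "graph_admissible \<eta>" shows "additive_map (ev1 \<eta> j)"
  using additive_mapD[OF additive_map_ev[OF admissible_sub1[OF assms]]]
  by (simp add: additive_map_def ev1_def)

lemma ev1_mult:
  assumes "graph_admissible \<eta>" "x \<in> carrier Q" "y \<in> carrier Q"
  shows "ev1 \<eta> j (x \<otimes>\<^bsub>Q\<^esub> y) = ev1 \<eta> j x * ev (sub0 \<eta>) y + ev (sub0 \<eta>) x * ev1 \<eta> j y"
  unfolding ev1_def ev_mult[OF admissible_sub1[OF assms(1)] assms(2,3)] coeff_1_mult coeff_0_ev_sub1 ..

lemma ev1_gen:
  assumes "graph_admissible \<eta>" "g \<in> V"
  shows "ev1 \<eta> j (gen g) = (if g = X 1 j then 1 else 0)"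
  unfolding ev1_def ev_gen[OF admissible_sub1[OF assms(1)] assms(2)] by (auto simp: sub1_def split: gen.splits)

lemma ev0_gen: "\<lbrakk>graph_admissible \<eta>; g \<in> V\<rbrakk> \<Longrightarrow> ev (sub0 \<eta>) (gen g) = sub0 \<eta> g"
  by (rule ev_gen[OF admissible_sub0])

text \<open>A y has degree 2p + 2 and \<open>X 1 j\<close> has degree 4, so constant terms live in
  multiples of 2p + 2 and linear terms in these multiples shifted by 4.\<close>

lemma monomial_eval_sub1_degree:
  fixes \<eta> :: "'v \<Rightarrow> 'c::comm_ring_1"
  assumes "Poly_Mapping.keys m \<subseteq> V"
  shows "(coeff (monomial_eval (sub1 \<eta> j) m) 0 \<noteq> 0 \<longrightarrow> (\<exists>n. monomial_degree (A_degree p) m = (2 * p + 2) * n)) \<and>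
    (coeff (monomial_eval (sub1 \<eta> j) m) 1 \<noteq> 0 \<longrightarrow> (\<exists>n. monomial_degree (A_degree p) m = 4 + (2 * p + 2) * n))"
  using assms
proof (induction m rule: monomial_induct)
  case zero
  then show ?case by (auto intro: exI[of _ 0])
next
  case (add m g)
  let ?e = "monomial_eval (sub1 \<eta> j)" and ?d = "monomial_degree (A_degree p)"
  have e: "?e (m + Poly_Mapping.single g 1) = ?e m * sub1 \<eta> j g"
    and d: "?d (m + Poly_Mapping.single g 1) = ?d m + A_degree p g"
    by (simp_all add: monomial_eval_add monomial_degree_add)
  note c0 = add.IH[THEN conjunct1, rule_format] and c1 = add.IH[THEN conjunct2, rule_format]
  show ?case
  proof (cases g)
    case (X k i)
    have "\<exists>n. ?d m + A_degree p g = 4 + (2 * p + 2) * n" if "coeff (?e m) 0 \<noteq> 0" "k = 1"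
      using c0[OF that(1)] that(2) X by (auto simp: algebra_simps)
    then show ?thesis unfolding e d coeff_mult_0 coeff_1_mult by (auto simp: X)
  next
    case (Y t)
    have "\<exists>n. ?d m + A_degree p g = (2 * p + 2) * n" if nz: "coeff (?e m) 0 \<noteq> 0"
    proof -
      obtain n where "?d m = (2 * p + 2) * n" using c0[OF nz] by blast
      then show ?thesis using Y by (intro exI[of _ "Suc n"]) simp
    qed
    moreover have "\<exists>n. ?d m + A_degree p g = 4 + (2 * p + 2) * n" if nz: "coeff (?e m) 1 \<noteq> 0"
    proof -
      obtain n where "?d m = 4 + (2 * p + 2) * n" using c1[OF nz] by blast
      then show ?thesis using Y by (intro exI[of _ "Suc n"]) simp
    qed
    moreover have "coeff (sub1 \<eta> j g) 0 = \<eta> t" "coeff (sub1 \<eta> j g) 1 = 0" using Y by simp_all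
    ultimately show ?thesis
      unfolding e d coeff_mult_0 coeff_1_mult by (metis add.right_neutral mult_zero_left mult_zero_right)
  qed
qed

lemma ev0_grade_zero:
  assumes \<eta>: "graph_admissible \<eta>" and z: "z \<in> grade Q d" and d: "\<not> 2 * p + 2 dvd d"
  shows "ev (sub0 \<eta>) z = 0"
proof (rule additive_zero_grade[OF additive_map_ev[OF admissible_sub0[OF \<eta>]] _ z])
  fix m :: "'v gen monomial" assume m: "Poly_Mapping.keys m \<subseteq> V" "monomial_degree (A_degree p) m = d"
  have "coeff (monomial_eval (sub1 \<eta> 0) m) 0 = 0"
    using monomial_eval_sub1_degree[OF m(1), of \<eta> 0] d m(2) by (metis dvd_triv_left)
  then show "ev (sub0 \<eta>) (mon m) = 0"
    using coeff_0_ev_sub1[of \<eta> 0 "mon m"] ev_mon[OF admissible_sub1[OF \<eta>] m(1), of 0] by simp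
qed

lemma ev1_grade_zero:
  assumes \<eta>: "graph_admissible \<eta>" and z: "z \<in> grade Q d" and d: "\<And>n. d \<noteq> 4 + (2 * p + 2) * n"
  shows "ev1 \<eta> j z = 0"
proof (rule additive_zero_grade[OF additive_map_ev1[OF \<eta>] _ z])
  fix m :: "'v gen monomial" assume m: "Poly_Mapping.keys m \<subseteq> V" "monomial_degree (A_degree p) m = d"
  then show "ev1 \<eta> j (mon m) = 0"
    using monomial_eval_sub1_degree[OF m(1), of \<eta> j] d ev_mon[OF admissible_sub1[OF \<eta>] m(1), of j]
    by (auto simp: ev1_def)
qed

lemma monomial_degree_eq_0_iff: "monomial_degree (A_degree p) m = 0 \<longleftrightarrow> m = 0"
proof
  assume "monomial_degree (A_degree p) m = 0"
  then have *: "\<forall>g\<in>Poly_Mapping.keys m. Poly_Mapping.lookup m g * A_degree p g = 0"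
    by (simp add: monomial_degree_def)
  have "g \<notin> Poly_Mapping.keys m" for g
    using bspec[OF *, of g] by (cases g) (auto simp: in_keys_iff)
  then have "Poly_Mapping.keys m = {}" by blast
  then show "m = 0" by simp
qed simp

lemma monomial_eval_sub0_X:
  assumes "X k i \<in> Poly_Mapping.keys m" shows "monomial_eval (sub0 \<eta>) m = 0"
  unfolding monomial_eval_def using assms
  by (intro prod_zero) (auto simp: in_keys_iff power_0_left intro!: bexI[of _ "X k i"])

text \<open>A single \<open>X k i\<close> has degree below 2p + 2, so a monomial without any y has
  at least two factors. Its parts have half degrees p - k and k + 1 with sum p + 1, which is the
  tight case of \<open>coeff_1_ev_P_decomposable\<close> for \<open>P^p\<close>.\<close>

lemma monomial_of_degree_Y:
  assumes m: "Poly_Mapping.keys m \<subseteq> V" and d: "monomial_degree (A_degree p) m = 2 * p + 2"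
  obtains (single) t where "t \<in> pverts G" "m = Poly_Mapping.single (Y t) 1"
    | (decomposable) k i n where "X k i \<in> V" "m = n + Poly_Mapping.single (X k i) 1" "Poly_Mapping.keys n \<subseteq> V"
        "monomial_degree (A_degree p) n = 2 * (p - k)" "k < p" "\<exists>k i. X k i \<in> Poly_Mapping.keys n"
proof -
  have split: "\<exists>n. m = n + Poly_Mapping.single g 1 \<and> Poly_Mapping.keys n \<subseteq> Poly_Mapping.keys m"
    if "g \<in> Poly_Mapping.keys m" for g
  proof (intro exI conjI)
    show "m = (m - Poly_Mapping.single g 1) + Poly_Mapping.single g 1" using that
      by (intro poly_mapping_eqI) (auto simp: lookup_add lookup_minus lookup_single in_keys_iff when_def)
    show "Poly_Mapping.keys (m - Poly_Mapping.single g 1) \<subseteq> Poly_Mapping.keys m"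
      by (auto simp: in_keys_iff lookup_minus)
  qed
  show thesis
  proof (cases "\<exists>t. Y t \<in> Poly_Mapping.keys m")
    case True
    then obtain t n where t: "Y t \<in> Poly_Mapping.keys m" "m = n + Poly_Mapping.single (Y t) 1"
      using split by blast
    then have "n = 0" using d by (simp add: monomial_degree_add monomial_degree_eq_0_iff)
    then show thesis using single[of t] t m Y_in_V by auto
  next
    case False
    have "m \<noteq> 0" using d by auto
    then obtain g where g: "g \<in> Poly_Mapping.keys m" by (metis ex_in_conv keys_eq_empty)
    then obtain k i where "g = X k i" using False by (cases g) auto
    then obtain n where n: "m = n + Poly_Mapping.single (X k i) 1" "Poly_Mapping.keys n \<subseteq> Poly_Mapping.keys m"
      using split g by blast
    have X: "X k i \<in> V" using g \<open>g = X k i\<close> m by blast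
    then have k: "k < p" using X_in_V[of k i] p_ge_3 by auto
    have dn: "monomial_degree (A_degree p) n = 2 * (p - k)"
      using d n(1) by (simp add: monomial_degree_add)
    then have "n \<noteq> 0" using k by auto
    then obtain g' where g': "g' \<in> Poly_Mapping.keys n" by (metis ex_in_conv keys_eq_empty)
    then obtain k' i' where "g' = X k' i'" using False n(2) by (cases g') auto
    then show thesis using decomposable[of k i n] X n m k dn g' by blast
  qed
qed

end

section \<open>First-order behavior of \<open>P^1\<close> and \<open>P^p\<close> on the
  generators\<close>

context graph_steenrod
begin

text \<open>\<open>xcoef i t\<close> is the coefficient of \<open>Y t\<close> in \<open>P\<^sup>1\<close> of \<open>X 1 i\<close>, and \<open>ycoef \<eta> t j\<close> is that of \<open>X 1 j\<close> in
  \<open>P\<^sup>p\<close> of \<open>Y t\<close>, a polynomial in the variables of the graph evaluated at \<open>\<eta>\<close>.\<close>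

definition xcoef :: "nat \<Rightarrow> 'v \<Rightarrow> 'k::comm_ring_1" where
  "xcoef i t = ev (sub0 (\<lambda>u. if u = t then 1 else 0)) (P 1 (gen (X 1 i)))"

definition ycoef :: "('v \<Rightarrow> 'c::comm_ring_1) \<Rightarrow> 'v \<Rightarrow> nat \<Rightarrow> 'c" where
  "ycoef \<eta> t j = ev1 \<eta> j (P p (gen (Y t)))"

lemma gen_X_grade: "X k i \<in> V \<Longrightarrow> gen (X k i) \<in> grade Q (2 * k + 2)"
  using gen_grade[of "X k i"] by simp

lemma gen_Y_grade: "t \<in> pverts G \<Longrightarrow> gen (Y t) \<in> grade Q (2 * p + 2)"
  using gen_grade[of "Y t"] by (simp add: Y_in_V)

lemma gen_Y_carrier: "t \<in> pverts G \<Longrightarrow> gen (Y t) \<in> carrier Q"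
  by (rule gen_carrier) (simp add: Y_in_V)

lemma X1_in_V: "i \<in> {1..s 1} \<Longrightarrow> X 1 i \<in> V"
  using p_ge_3 by (simp add: X_in_V)

lemma graph_admissible_indicator:
  assumes "of_nat p = (0 :: 'k::comm_ring_1)" "t \<in> pverts G"
  shows "graph_admissible (\<lambda>u. if u = t then 1 else 0 :: 'k)"
  unfolding graph_admissible_def
proof (intro conjI allI impI assms(1))
  fix \<tau> assume \<tau>: "\<tau> \<subseteq> pverts G" "\<tau> \<notin> graph_complex G"
  then have "\<tau> \<noteq> {}" "\<tau> \<noteq> {t}" using assms(2) by (auto simp: graph_complex_def)
  then obtain u where "u \<in> \<tau>" "u \<noteq> t" by blast
  moreover have "finite \<tau>" by (rule finite_subset[OF \<tau>(1)]) simp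
  ultimately show "(\<Prod>u\<in>\<tau>. if u = t then 1 else 0 :: 'k) = 0"
    by (intro prod_zero) auto
qed

end

text \<open>Scalars and values live in different rings: \<open>xcoef\<close> is computed in
  \<open>'k\<close>, the graph variables are evaluated in \<open>'c\<close>, and \<open>emb\<close>
  carries scalars over. It is used with the indicator of one vertex in a field, and with the two
  variables of an edge in a bivariate polynomial ring.\<close>

locale graph_ev = graph_steenrod G p s P
  for G :: "'v pair_pre_digraph" and p s P +
  fixes \<eta> :: "'v \<Rightarrow> 'c::comm_ring_1" and emb :: "'k::comm_ring_1 \<Rightarrow> 'c"
  assumes \<eta>: "graph_admissible \<eta>" and char_k: "of_nat p = (0 :: 'k)"
    and emb_add: "emb (a + b) = emb a + emb b" and emb_1: "emb 1 = 1"
begin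

lemma emb_0: "emb 0 = 0"
  using emb_add[of 0 0] by simp

abbreviation "N \<equiv> ev (sub0 \<eta>)"
abbreviation "N_ind t \<equiv> ev (sub0 (\<lambda>u. if u = t then 1 else 0 :: 'k))"
abbreviation "L \<equiv> ev1 \<eta>"
abbreviation "comm0 \<equiv> ev_comm (sub0 \<eta>)"
abbreviation "comm1 j z \<equiv> coeff (ev_comm (sub1 \<eta> j) z) 1"

lemmas adm0 = admissible_sub0[OF \<eta>] and adm1 = admissible_sub1[OF \<eta>]

lemma char_c: "of_nat p = (0 :: 'c)" "of_nat p = (0 :: 'c poly)"
  using \<eta> by (simp_all add: graph_admissible_def of_nat_poly)

lemma N_mult: "\<lbrakk>x \<in> carrier Q; y \<in> carrier Q\<rbrakk> \<Longrightarrow> N (x \<otimes>\<^bsub>Q\<^esub> y) = N x * N y"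
  by (rule ev_mult[OF adm0])

lemma N_gen: "g \<in> V \<Longrightarrow> N (gen g) = sub0 \<eta> g"
  by (rule ev0_gen[OF \<eta>])

lemma N_P1_mult:
  assumes "x \<in> carrier Q" "y \<in> carrier Q"
  shows "N (P 1 (x \<otimes>\<^bsub>Q\<^esub> y)) = N (P 1 x) * N y + N x * N (P 1 y)"
  unfolding ev_P_mult[OF adm0 assms] by (simp add: P_0 assms)

text \<open>A chain rule. Both sides are derivations along \<open>N\<close>, and on generators other
  than the \<open>X 1 i\<close> the degree of \<open>P^1\<close> is no multiple of 2p + 2.\<close>

lemma N_P1:
  assumes "z \<in> carrier Q"
  shows "N (P 1 z) = (\<Sum>i\<in>{1..s 1}. L i z * N (P 1 (gen (X 1 i))))"
proof -
  define \<psi> where "\<psi> z = N (P 1 z) - (\<Sum>i\<in>{1..s 1}. L i z * N (P 1 (gen (X 1 i))))" for z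
  have "\<psi> z = 0"
  proof (rule derivation_zero[of \<psi> N, OF _ _ ev_one[OF adm0] _ assms])
    show "additive_map \<psi>"
      using additive_mapD[OF additive_map_P[OF additive_map_ev[OF adm0]]] additive_mapD[OF additive_map_ev1[OF \<eta>]]
      by (simp add: additive_map_def \<psi>_def distrib_right sum.distrib del: One_nat_def)
    fix x y assume xy: "x \<in> carrier Q" "y \<in> carrier Q"
    show "\<psi> (x \<otimes>\<^bsub>Q\<^esub> y) = \<psi> x * N y + N x * \<psi> y"
      unfolding \<psi>_def N_P1_mult[OF xy] ev1_mult[OF \<eta> xy]
      by (simp add: algebra_simps sum.distrib sum_distrib_left del: One_nat_def)
  next
    fix g assume g: "g \<in> V"
    then show "\<psi> (gen g) = 0"
    proof (cases rule: V_cases)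
      case (X1 i)
      have "(\<Sum>j\<in>{1..s 1}. L j (gen g) * N (P 1 (gen (X 1 j)))) = (\<Sum>j\<in>{1..s 1}. if j = i then N (P 1 (gen (X 1 i))) else 0)"
        by (intro sum.cong refl) (simp add: ev1_gen[OF \<eta> g, unfolded X1(1)] X1(1) del: One_nat_def)
      then show ?thesis using X1 by (simp add: \<psi>_def del: One_nat_def)
    next
      case (X k i)
      have "P 1 (gen g) \<in> grade Q (2 * k + 2 + 2 * 1 * (p - 1))"
        using degree[OF gen_X_grade[of k i], of 1] g X by simp
      \<comment> \<open>The degree is 2p + 2k with 1 < k < p, strictly between 2p + 2 and its
        double.\<close>
      moreover have "\<not> 2 * p + 2 dvd 2 * k + 2 + 2 * 1 * (p - 1)"
      proof
        assume "2 * p + 2 dvd 2 * k + 2 + 2 * 1 * (p - 1)"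
        then obtain q where q: "2 * k + 2 + 2 * 1 * (p - 1) = (2 * p + 2) * q" by (rule dvdE)
        then have "(2 * p + 2) * 1 < (2 * p + 2) * q" "(2 * p + 2) * q < (2 * p + 2) * 2"
          unfolding q[symmetric] using X(2,3) p_ge_3 by auto
        then have "1 < q" "q < 2" by (simp_all only: nat_mult_less_cancel1)
        then show False by simp
      qed
      ultimately have "N (P 1 (gen g)) = 0" by (rule ev0_grade_zero[OF \<eta>])
      moreover have "L j (gen g) = 0" for j unfolding ev1_gen[OF \<eta> g] using X by simp
      ultimately show ?thesis by (simp add: \<psi>_def)
    next
      case (Y t)
      have "P 1 (gen g) \<in> grade Q (2 * p + 2 + 2 * 1 * (p - 1))"
        using degree[OF gen_Y_grade[of t], of 1] Y by simp
      moreover have "\<not> 2 * p + 2 dvd 2 * p + 2 + 2 * 1 * (p - 1)"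
        unfolding dvd_add_right_iff[OF dvd_refl] using p_ge_3 by (intro nat_dvd_not_less) auto
      ultimately have "N (P 1 (gen g)) = 0" by (rule ev0_grade_zero[OF \<eta>])
      moreover have "L j (gen g) = 0" for j unfolding ev1_gen[OF \<eta> g] using Y by simp
      ultimately show ?thesis by (simp add: \<psi>_def)
    qed
  qed
  then show ?thesis by (simp add: \<psi>_def)
qed

text \<open>A functional that kills products of the \<open>X k i\<close> is determined in degree 2p
  + 2 by the y_t. The vanishing of \<open>N_ind\<close> on a factor is passed on because the
  functionals of interest are compared with linear combinations of the \<open>N_ind\<close>.\<close>

lemma grade_Y_additive_zero:
  fixes \<psi> :: "_ \<Rightarrow> 'd::ab_group_add"
  assumes "additive_map \<psi>"
    and Y: "\<And>t. t \<in> pverts G \<Longrightarrow> \<psi> (gen (Y t)) = 0"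
    and X: "\<And>k x y. \<lbrakk>k < p; x \<in> grade Q (2 * (p - k)); y \<in> grade Q (2 * (k + 1));
      N x = 0; N y = 0; \<And>t. t \<in> pverts G \<Longrightarrow> N_ind t x = 0\<rbrakk> \<Longrightarrow> \<psi> (x \<otimes>\<^bsub>Q\<^esub> y) = 0"
    and "z \<in> grade Q (2 * p + 2)"
  shows "\<psi> z = 0"
proof (rule additive_zero_grade[OF assms(1) _ assms(4)])
  fix m :: "'v gen monomial"
  assume m: "Poly_Mapping.keys m \<subseteq> V" "monomial_degree (A_degree p) m = 2 * p + 2"
  from m show "\<psi> (mon m) = 0"
  proof (cases rule: monomial_of_degree_Y)
    case (single t)
    then show ?thesis using Y by (simp add: gen_def)
  next
    case (decomposable k i n)
    then obtain k' i' where n: "X k' i' \<in> Poly_Mapping.keys n" by blast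
    have "mon m = mon n \<otimes>\<^bsub>Q\<^esub> gen (X k i)"
      using mon_add[OF decomposable(3), of "Poly_Mapping.single (X k i) 1"] decomposable(1,2)
      by (simp add: gen_def)
    moreover have "\<psi> (mon n \<otimes>\<^bsub>Q\<^esub> gen (X k i)) = 0"
    proof (rule X[OF decomposable(5)])
      show "mon n \<in> grade Q (2 * (p - k))" using mon_grade[OF decomposable(3)] decomposable(4) by simp
      show "gen (X k i) \<in> grade Q (2 * (k + 1))" using gen_X_grade[OF decomposable(1)] by simp
      show "N (mon n) = 0"
        using ev_mon[OF adm0 decomposable(3)] monomial_eval_sub0_X[OF n] by simp
      show "N (gen (X k i)) = 0" using N_gen[OF decomposable(1)] by simp
      show "N_ind t (mon n) = 0" if "t \<in> pverts G" for t
        using ev_mon[OF admissible_sub0[OF graph_admissible_indicator[OF char_k that]] decomposable(3)]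
          monomial_eval_sub0_X[OF n] by simp
    qed
    ultimately show ?thesis by simp
  qed
qed

lemma adm_ind: "t \<in> pverts G \<Longrightarrow> admissible (sub0 (\<lambda>u. if u = t then 1 else 0 :: 'k))"
  by (rule admissible_sub0[OF graph_admissible_indicator[OF char_k]])

lemma additive_map_ind_sum:
  "additive_map (\<lambda>z. \<Sum>t\<in>pverts G. emb (N_ind t z) * c t)"
  by (simp add: additive_map_def additive_mapD[OF additive_map_ev[OF adm_ind]] emb_add distrib_right sum.distrib)

lemma ind_sum_Y:
  assumes "t \<in> pverts G"
  shows "(\<Sum>u\<in>pverts G. emb (N_ind u (gen (Y t))) * c u) = c t"
proof -
  have "(\<Sum>u\<in>pverts G. emb (N_ind u (gen (Y t))) * c u) = (\<Sum>u\<in>pverts G. if u = t then c t else 0)"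
    by (intro sum.cong refl)
      (use assms in \<open>auto simp: ev_gen[OF adm_ind] Y_in_V emb_0 emb_1\<close>)
  then show ?thesis using assms by simp
qed

lemma ind_sum_X:
  assumes "x \<in> carrier Q" "y \<in> carrier Q" "\<And>t. t \<in> pverts G \<Longrightarrow> N_ind t x = 0"
  shows "(\<Sum>u\<in>pverts G. emb (N_ind u (x \<otimes>\<^bsub>Q\<^esub> y)) * c u) = 0"
  by (intro sum.neutral ballI) (simp add: ev_mult[OF adm_ind assms(1,2)] assms(3) emb_0)

lemma N_grade_Y:
  assumes "z \<in> grade Q (2 * p + 2)"
  shows "N z = (\<Sum>t\<in>pverts G. emb (N_ind t z) * \<eta> t)"
proof -
  define \<psi> where "\<psi> z = N z - (\<Sum>t\<in>pverts G. emb (N_ind t z) * \<eta> t)" for z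
  have "\<psi> z = 0"
  proof (rule grade_Y_additive_zero[OF _ _ _ assms])
    show "additive_map \<psi>"
      using additive_mapD[OF additive_map_ev[OF adm0]] additive_mapD[OF additive_map_ind_sum]
      by (simp add: additive_map_def \<psi>_def)
    show "\<psi> (gen (Y t)) = 0" if "t \<in> pverts G" for t
      using that by (simp add: \<psi>_def ind_sum_Y N_gen Y_in_V)
    show "\<psi> (x \<otimes>\<^bsub>Q\<^esub> y) = 0"
      if "x \<in> grade Q (2 * (p - k))" "y \<in> grade Q (2 * (k + 1))" "N x = 0" "N y = 0"
        "\<And>t. t \<in> pverts G \<Longrightarrow> N_ind t x = 0" for k x y
      using that grade_carrier by (simp add: \<psi>_def ind_sum_X N_mult)
  qed
  then show ?thesis by (simp add: \<psi>_def)
qed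

text \<open>To first order \<open>P^p\<close> kills the decomposable monomials of degree 2p + 2, so
  only the linear part in the y_t matters. The application is to z = \<open>P^1 x_i\<close>, in the
  computation of D x_i.\<close>

lemma L_Pp_grade_Y:
  assumes "z \<in> grade Q (2 * p + 2)"
  shows "L j (P p z) = (\<Sum>t\<in>pverts G. emb (N_ind t z) * ycoef \<eta> t j)"
proof -
  define \<psi> where "\<psi> z = L j (P p z) - (\<Sum>t\<in>pverts G. emb (N_ind t z) * ycoef \<eta> t j)" for z
  have "\<psi> z = 0"
  proof (rule grade_Y_additive_zero[OF _ _ _ assms])
    show "additive_map \<psi>"
      using additive_mapD[OF additive_map_P[OF additive_map_ev1[OF \<eta>]]] additive_mapD[OF additive_map_ind_sum]
      by (simp add: additive_map_def \<psi>_def)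
    show "\<psi> (gen (Y t)) = 0" if "t \<in> pverts G" for t
      using that by (simp add: \<psi>_def ind_sum_Y ycoef_def)
    show "\<psi> (x \<otimes>\<^bsub>Q\<^esub> y) = 0"
      if "k < p" "x \<in> grade Q (2 * (p - k))" "y \<in> grade Q (2 * (k + 1))" "N x = 0" "N y = 0"
        "\<And>t. t \<in> pverts G \<Longrightarrow> N_ind t x = 0" for k x y
    proof -
      have "coeff (ev (sub1 \<eta> j) (P p (x \<otimes>\<^bsub>Q\<^esub> y))) 1 = 0"
        by (rule coeff_1_ev_P_decomposable[OF adm1 that(2,3)])
          (use that in \<open>simp_all add: coeff_0_ev_sub1\<close>)
      then show ?thesis using that grade_carrier by (simp add: \<psi>_def ind_sum_X ev1_def)
    qed
  qed
  then show ?thesis by (simp add: \<psi>_def)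
qed

lemma P1_X1_grade: "i \<in> {1..s 1} \<Longrightarrow> P 1 (gen (X 1 i)) \<in> grade Q (2 * p + 2)"
proof -
  assume i: "i \<in> {1..s 1}"
  have "2 * 1 + 2 + 2 * 1 * (p - 1) = 2 * p + 2" using p_ge_3 by simp
  then show ?thesis using degree[OF gen_X_grade[OF X1_in_V[OF i]], of 1] by (simp only:)
qed

lemma N_P1_X1:
  assumes "i \<in> {1..s 1}"
  shows "N (P 1 (gen (X 1 i))) = (\<Sum>t\<in>pverts G. emb (xcoef i t) * \<eta> t)"
  unfolding N_grade_Y[OF P1_X1_grade[OF assms]] xcoef_def ..

lemma P_1_P_p_Y:
  fixes \<psi> :: "_ \<Rightarrow> 'd::comm_ring_1"
  assumes "additive_map \<psi>" "of_nat p = (0 :: 'd)" "t \<in> pverts G"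
  shows "\<psi> (P 1 (P p (gen (Y t)))) = \<psi> (gen (Y t) [^]\<^bsub>Q\<^esub> p)"
proof -
  have "P (p + 1) (gen (Y t)) = gen (Y t) [^]\<^bsub>Q\<^esub> p"
    by (rule power) (use gen_Y_grade[OF assms(3)] in simp)
  then show ?thesis
    using P_1_P[OF assms(1,2) gen_Y_carrier[OF assms(3)], of p] assms(2) by simp
qed

text \<open>The equation M y = y^(p) before restriction to an edge: \<open>P^1 P^p y_t\<close> is
  computed once by the Adem relation and once by the chain rule \<open>N_P1\<close>.\<close>

lemma ycoef_relation:
  assumes "t \<in> pverts G"
  shows "\<eta> t ^ p = (\<Sum>i\<in>{1..s 1}. ycoef \<eta> t i * (\<Sum>u\<in>pverts G. emb (xcoef i u) * \<eta> u))"
proof -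
  have "\<eta> t ^ p = N (gen (Y t) [^]\<^bsub>Q\<^esub> p)"
    using ev_pow[OF adm0 gen_Y_carrier[OF assms]] N_gen[of "Y t"] assms by (simp add: Y_in_V)
  also have "\<dots> = N (P 1 (P p (gen (Y t))))"
    using P_1_P_p_Y[OF additive_map_ev[OF adm0] char_c(1) assms] by simp
  also have "\<dots> = (\<Sum>i\<in>{1..s 1}. ycoef \<eta> t i * N (P 1 (gen (X 1 i))))"
    unfolding N_P1[OF closed[OF gen_Y_carrier[OF assms]]] ycoef_def ..
  finally show ?thesis by (simp add: N_P1_X1 del: One_nat_def)
qed

lemma comm1_Pp_Y:
  assumes "t \<in> pverts G"
  shows "comm1 j (P p (gen (Y t))) = 0"
proof -
  let ?y = "gen (Y t)" and ?e = "ev (sub1 \<eta> j)"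
  note y = gen_Y_carrier[OF assms]
  have add: "additive_map (\<lambda>z. ?e (P a z))" for a
    by (rule additive_map_P[OF additive_map_ev[OF adm1]])
  have "?e (P p (P 1 (P p ?y))) = ?e (P p (?y [^]\<^bsub>Q\<^esub> p))"
    by (rule P_1_P_p_Y[OF add char_c(2) assms])
  moreover have "?e (P 1 (P p (P p ?y))) = 0"
  proof -
    have "P (2 * p) ?y = \<zero>\<^bsub>Q\<^esub>"
      by (rule unstable[OF gen_Y_grade[OF assms]]) (use p_ge_3 in simp)
    then have "?e (P 1 (P p (P p ?y))) = ?e (P 1 (P (2 * p - 1) (P 1 ?y)))"
      by (rule P_p_P_p[OF add char_c(2) y])
    \<comment> \<open>The index 2p - 1 is the one for which the scalar b + 1 of \<open>P_1_P\<close>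
      becomes 2p, which is 0 in characteristic p.\<close>
    also have "\<dots> = of_nat (2 * p - 1 + 1) * ?e (P (2 * p - 1 + 1) (P 1 ?y))"
      by (rule P_1_P[OF additive_map_ev[OF adm1] char_c(2) closed[OF y]])
    also have "of_nat (2 * p - 1 + 1) = (of_nat 2 * of_nat p :: 'c poly)"
      using p_ge_3 unfolding of_nat_mult[symmetric] by simp
    finally show ?thesis using char_c(2) by simp
  qed
  ultimately show ?thesis
    using coeff_1_ev_P_pow[OF adm1 y, of j p] by (simp add: ev_comm_def del: One_nat_def)
qed

lemma comm1_X1:
  assumes "i \<in> {1..s 1}"
  shows "comm1 j (gen (X 1 i)) = (\<Sum>t\<in>pverts G. emb (xcoef i t) * ycoef \<eta> t j)"
proof -
  have "P p (gen (X 1 i)) = \<zero>\<^bsub>Q\<^esub>"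
    by (rule unstable[OF gen_X_grade[OF X1_in_V[OF assms]]]) (use p_ge_3 in simp)
  then have "ev (sub1 \<eta> j) (P 1 (P p (gen (X 1 i)))) = 0"
    using additive_map_zero[OF additive_map_P[OF additive_map_ev[OF adm1]]] by simp
  then have "comm1 j (gen (X 1 i)) = L j (P p (P 1 (gen (X 1 i))))"
    by (simp add: ev_comm_def ev1_def del: One_nat_def)
  then show ?thesis
    unfolding L_Pp_grade_Y[OF P1_X1_grade[OF assms]] xcoef_def .
qed

text \<open>Both composites shift degrees by 2 (p^2 - 1), written as a multiple of 2p + 2 so that
  the residue tests for \<open>N\<close> and \<open>L\<close> apply to d itself.\<close>

lemma comm_grades:
  assumes "z \<in> grade Q d"
  shows "P p (P 1 z) \<in> grade Q (d + (2 * p + 2) * (p - 1))" "P 1 (P p z) \<in> grade Q (d + (2 * p + 2) * (p - 1))"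
proof -
  have "d + 2 * 1 * x + 2 * p * x = d + (2 * p + 2) * x" "d + 2 * p * x + 2 * 1 * x = d + (2 * p + 2) * x" for x
    by (simp_all add: distrib_right)
  then show "P p (P 1 z) \<in> grade Q (d + (2 * p + 2) * (p - 1))" "P 1 (P p z) \<in> grade Q (d + (2 * p + 2) * (p - 1))"
    using degree[OF degree[OF assms, of 1], of p] degree[OF degree[OF assms, of p], of 1] by (simp_all only:)
qed

lemma comm0_grade_zero:
  assumes "z \<in> grade Q d" "\<not> 2 * p + 2 dvd d"
  shows "comm0 z = 0"
proof -
  have "\<not> 2 * p + 2 dvd d + (2 * p + 2) * (p - 1)"
    unfolding dvd_add_left_iff[OF dvd_triv_left] by (rule assms(2))
  note zero = comm_grades[OF assms(1), THEN ev0_grade_zero[OF \<eta> _ this]]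
  show ?thesis unfolding ev_comm_def zero by simp
qed

lemma comm1_grade_zero:
  assumes "z \<in> grade Q d" "\<And>n. d \<noteq> 4 + (2 * p + 2) * n" "d < 4 + (2 * p + 2)"
  shows "comm1 j z = 0"
proof -
  have "d + (2 * p + 2) * (p - 1) \<noteq> 4 + (2 * p + 2) * n" for n
  proof
    assume *: "d + (2 * p + 2) * (p - 1) = 4 + (2 * p + 2) * n"
    show False
    proof (cases "p - 1 \<le> n")
      case True
      then obtain k where "n = p - 1 + k" using le_Suc_ex by blast
      then show False using * assms(2)[of k] by (simp add: distrib_left)
    next
      case False
      then obtain k where k: "p - 1 = n + Suc k" by (metis less_imp_Suc_add not_le add_Suc_right)
      have "d + (2 * p + 2) * Suc k = 4" using * unfolding k by (simp add: algebra_simps)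
      then show False using p_ge_3 by simp
    qed
  qed
  then show ?thesis
    using comm_grades[OF assms(1), THEN ev1_grade_zero[OF \<eta>]] by (simp add: ev_comm_def ev1_def del: One_nat_def)
qed

context
  fixes \<delta> :: "'c \<Rightarrow> 'c"
  assumes \<delta>_add: "\<And>a b. \<delta> (a + b) = \<delta> a + \<delta> b"
    and \<delta>_mult: "\<And>a b. \<delta> (a * b) = \<delta> a * b + a * \<delta> b"
    and \<delta>_\<eta>: "\<And>t. t \<in> pverts G \<Longrightarrow> \<delta> (\<eta> t) = comm0 (gen (Y t))"
begin

lemma \<delta>_0: "\<delta> 0 = 0" and \<delta>_1: "\<delta> 1 = 0"
  using \<delta>_add[of 0 0] \<delta>_mult[of 1 1] by simp_all

text \<open>Evaluation after D is a derivation along \<open>N\<close> that vanishes on the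
  \<open>X k i\<close> by degree. It therefore factors through values once \<delta> has the right
  effect on the \<eta> t; on an edge, \<open>bivar_deriv\<close> supplies such a \<delta>.\<close>

lemma comm0_eq:
  assumes "z \<in> carrier Q" shows "comm0 z = \<delta> (N z)"
proof -
  define \<psi> where "\<psi> z = comm0 z - \<delta> (N z)" for z
  have "\<psi> z = 0"
  proof (rule derivation_zero[of \<psi> N, OF _ _ ev_one[OF adm0] _ assms])
    show "additive_map \<psi>"
      using additive_mapD[OF additive_map_ev_comm[OF adm0]] additive_mapD[OF additive_map_ev[OF adm0]]
      by (simp add: additive_map_def \<psi>_def \<delta>_add)
    show "\<psi> (x \<otimes>\<^bsub>Q\<^esub> y) = \<psi> x * N y + N x * \<psi> y" if "x \<in> carrier Q" "y \<in> carrier Q" for x y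
      unfolding \<psi>_def ev_comm_mult[OF adm0 that] N_mult[OF that] by (simp add: \<delta>_mult algebra_simps)
    fix g assume g: "g \<in> V"
    show "\<psi> (gen g) = 0"
    proof (cases g)
      case (X k i)
      then have "\<not> 2 * p + 2 dvd 2 * k + 2"
        using g X_in_V[of k i] p_ge_3 by (intro nat_dvd_not_less) auto
      then show ?thesis
        using comm0_grade_zero[OF gen_X_grade[of k i]] N_gen[OF g] g X by (simp add: \<psi>_def \<delta>_0)
    next
      case (Y t)
      then show ?thesis using \<delta>_\<eta>[of t] N_gen[OF g] g Y_in_V by (simp add: \<psi>_def)
    qed
  qed
  then show ?thesis by (simp add: \<psi>_def)
qed

text \<open>The linear term of D z has two sources: D acts on the coefficient of x_j through
  \<delta>, and on each x_i, weighted by \<open>L i z\<close>. The term \<delta> (L j z) absorbs the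
  cross terms of the Leibniz rule, so that the difference of the two sides is a derivation along
  \<open>N\<close>.\<close>

lemma comm1_eq:
  assumes "z \<in> carrier Q"
  shows "comm1 j z = \<delta> (L j z) + (\<Sum>i\<in>{1..s 1}. L i z * comm1 j (gen (X 1 i)))"
proof -
  define \<psi> where "\<psi> z = comm1 j z - \<delta> (L j z) - (\<Sum>i\<in>{1..s 1}. L i z * comm1 j (gen (X 1 i)))" for z
  have c0: "coeff (ev_comm (sub1 \<eta> j) z) 0 = \<delta> (N z)" if "z \<in> carrier Q" for z
    using comm0_eq[OF that] by (simp add: ev_comm_def coeff_0_ev_sub1)
  have "\<psi> z = 0"
  proof (rule derivation_zero[of \<psi> N, OF _ _ ev_one[OF adm0] _ assms])
    show "additive_map \<psi>"
      using additive_mapD[OF additive_map_ev_comm[OF adm1]] additive_mapD[OF additive_map_ev1[OF \<eta>]]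
      by (simp add: additive_map_def \<psi>_def \<delta>_add distrib_right sum.distrib del: One_nat_def)
    show "\<psi> (x \<otimes>\<^bsub>Q\<^esub> y) = \<psi> x * N y + N x * \<psi> y" if "x \<in> carrier Q" "y \<in> carrier Q" for x y
    proof -
      have "comm1 j (x \<otimes>\<^bsub>Q\<^esub> y) = comm1 j x * N y + \<delta> (N x) * L j y + L j x * \<delta> (N y) + N x * comm1 j y"
        unfolding ev_comm_mult[OF adm1 that] coeff_add coeff_1_mult c0[OF that(1)] c0[OF that(2)]
          coeff_0_ev_sub1 ev1_def by simp
      moreover have "\<delta> (L j (x \<otimes>\<^bsub>Q\<^esub> y))
        = \<delta> (L j x) * N y + L j x * \<delta> (N y) + \<delta> (N x) * L j y + N x * \<delta> (L j y)"
        unfolding ev1_mult[OF \<eta> that] by (simp add: \<delta>_add \<delta>_mult)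
      moreover have "(\<Sum>i\<in>{1..s 1}. L i (x \<otimes>\<^bsub>Q\<^esub> y) * comm1 j (gen (X 1 i)))
        = (\<Sum>i\<in>{1..s 1}. L i x * comm1 j (gen (X 1 i))) * N y + N x * (\<Sum>i\<in>{1..s 1}. L i y * comm1 j (gen (X 1 i)))"
        unfolding ev1_mult[OF \<eta> that]
        by (simp add: algebra_simps sum.distrib sum_distrib_left del: One_nat_def)
      ultimately show ?thesis unfolding \<psi>_def by (simp only: algebra_simps)
    qed
    fix g assume g: "g \<in> V"
    then show "\<psi> (gen g) = 0"
    proof (cases rule: V_cases)
      case (X1 i)
      have "(\<Sum>l\<in>{1..s 1}. L l (gen g) * comm1 j (gen (X 1 l)))
        = (\<Sum>l\<in>{1..s 1}. if l = i then comm1 j (gen (X 1 i)) else 0)"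
        by (intro sum.cong refl) (simp add: ev1_gen[OF \<eta> g, unfolded X1(1)] X1(1) del: One_nat_def)
      moreover have "\<delta> (L j (gen g)) = 0"
        by (simp add: ev1_gen[OF \<eta> g] \<delta>_0 \<delta>_1)
      ultimately show ?thesis using X1 by (simp add: \<psi>_def del: One_nat_def)
    next
      case (X k i)
      have "comm1 j (gen g) = 0"
      proof (rule comm1_grade_zero)
        show "gen g \<in> grade Q (2 * k + 2)" using gen_X_grade g X by simp
        show "2 * k + 2 < 4 + (2 * p + 2)" using X by simp
        show "2 * k + 2 \<noteq> 4 + (2 * p + 2) * n" for n
          using X p_ge_3 by (cases n) auto
      qed
      moreover have "L l (gen g) = 0" for l unfolding ev1_gen[OF \<eta> g] using X by simp
      ultimately show ?thesis by (simp add: \<psi>_def \<delta>_0 del: One_nat_def)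
    next
      case (Y t)
      have "comm1 j (gen g) = 0"
      proof (rule comm1_grade_zero)
        show "gen g \<in> grade Q (2 * p + 2)" using gen_Y_grade Y by simp
        show "2 * p + 2 \<noteq> 4 + (2 * p + 2) * n" for n
          using p_ge_3 by (cases n) auto
      qed simp
      moreover have "L l (gen g) = 0" for l unfolding ev1_gen[OF \<eta> g] using Y by simp
      ultimately show ?thesis by (simp add: \<psi>_def \<delta>_0 del: One_nat_def)
    qed
  qed
  then show ?thesis by (simp add: \<psi>_def algebra_simps)
qed

lemma ycoef_derivation:
  assumes "v \<in> pverts G"
  shows "\<delta> (ycoef \<eta> v j) = - (\<Sum>i\<in>{1..s 1}. ycoef \<eta> v i * (\<Sum>t\<in>pverts G. emb (xcoef i t) * ycoef \<eta> t j))"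
proof -
  have "0 = \<delta> (ycoef \<eta> v j) + (\<Sum>i\<in>{1..s 1}. ycoef \<eta> v i * comm1 j (gen (X 1 i)))"
    using comm1_eq[OF closed[OF gen_Y_carrier[OF assms]], of j p] comm1_Pp_Y[OF assms, of j]
    by (simp add: ycoef_def del: One_nat_def)
  then show ?thesis by (simp add: comm1_X1 eq_neg_iff_add_eq_0 del: One_nat_def)
qed

end

end

section \<open>Edges\<close>

lemma of_nat_nonzero_below_char:
  assumes "prime p" "of_nat p = (0 :: 'k::field)" "0 < n" "n < p"
  shows "of_nat n \<noteq> (0 :: 'k)"
proof
  assume "of_nat n = (0 :: 'k)"
  then have "CHAR('k) dvd n" "CHAR('k) dvd p" using assms(2) by (simp_all add: of_nat_eq_0_iff_char_dvd)
  moreover have "CHAR('k) \<noteq> 1" by simp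
  ultimately have "p dvd n" using assms(1) by (metis prime_nat_iff)
  then show False using assms(3,4) by (simp add: nat_dvd_not_less)
qed

context graph_steenrod
begin

lemma parcs_facts:
  assumes "(v, w) \<in> parcs G"
  shows "v \<in> pverts G" "w \<in> pverts G" "v \<noteq> w" "(w, v) \<in> parcs G"
proof -
  show "v \<in> pverts G" "w \<in> pverts G" "v \<noteq> w"
    using arc_fst_in_verts[OF assms] arc_snd_in_verts[OF assms] pair_no_loops[OF assms] by auto
  show "(w, v) \<in> parcs G" using pair_sym_arcs assms by (auto simp: symmetric_def elim: symE)
qed

text \<open>Base change, by comparing two derivations along the same evaluation. It specializes the
  forms of an edge to their values at a single vertex.\<close>

lemma ev1_hom:
  fixes h :: "'c::comm_ring_1 \<Rightarrow> 'd::comm_ring_1"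
  assumes \<eta>: "graph_admissible \<eta>" and h\<eta>: "graph_admissible (\<lambda>t. h (\<eta> t))"
    and h: "\<And>x y. h (x + y) = h x + h y" "\<And>x y. h (x * y) = h x * h y" "h 1 = 1"
    and z: "z \<in> carrier Q"
  shows "h (ev1 \<eta> j z) = ev1 (\<lambda>t. h (\<eta> t)) j z"
proof -
  have h0: "h 0 = 0" using h(1)[of 0 0] by simp
  have hd: "h (x - y) = h x - h y" for x y using h(1)[of "x - y" y] by simp
  have N: "h (ev (sub0 \<eta>) x) = ev (sub0 (\<lambda>t. h (\<eta> t))) x" for x
  proof -
    have "(\<lambda>g. h (sub0 \<eta> g)) = sub0 (\<lambda>t. h (\<eta> t))"
      by (rule ext) (simp add: sub0_def h0 split: gen.splits)
    then show ?thesis using ev_hom[of h "sub0 \<eta>" x, OF hd h(2,3)] by simp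
  qed
  define \<psi> where "\<psi> z = h (ev1 \<eta> j z) - ev1 (\<lambda>t. h (\<eta> t)) j z" for z
  have "\<psi> z = 0"
  proof (rule derivation_zero[of \<psi> "ev (sub0 (\<lambda>t. h (\<eta> t)))", OF _ _ ev_one[OF admissible_sub0[OF h\<eta>]] _ z])
    show "additive_map \<psi>"
      using additive_mapD[OF additive_map_ev1[OF \<eta>]] additive_mapD[OF additive_map_ev1[OF h\<eta>]]
      by (simp add: additive_map_def \<psi>_def h(1))
    show "\<psi> (x \<otimes>\<^bsub>Q\<^esub> y) = \<psi> x * ev (sub0 (\<lambda>t. h (\<eta> t))) y + ev (sub0 (\<lambda>t. h (\<eta> t))) x * \<psi> y"
      if "x \<in> carrier Q" "y \<in> carrier Q" for x y
      unfolding \<psi>_def ev1_mult[OF \<eta> that] ev1_mult[OF h\<eta> that] by (simp add: h N algebra_simps)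
    show "\<psi> (gen g) = 0" if "g \<in> V" for g
      unfolding \<psi>_def ev1_gen[OF \<eta> that] ev1_gen[OF h\<eta> that] by (simp add: h(3) h0)
  qed
  then show ?thesis by (simp add: \<psi>_def)
qed

lemma Y_triple_zero:
  assumes "t \<in> pverts G" "v \<in> pverts G" "w \<in> pverts G" "t \<noteq> v" "t \<noteq> w" "v \<noteq> w"
  shows "gen (Y t) \<otimes>\<^bsub>Q\<^esub> (gen (Y v) \<otimes>\<^bsub>Q\<^esub> gen (Y w)) = \<zero>\<^bsub>Q\<^esub>"
proof -
  let ?\<sigma> = "{Y t, Y v, Y w}"
  have V: "?\<sigma> \<subseteq> V" using assms by (simp add: Y_in_V)
  have "{u. Y u \<in> ?\<sigma>} = {t, v, w}" by auto
  moreover have "{t, v, w} \<notin> graph_complex G"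
  proof
    have "card \<tau> \<le> 2" if "\<tau> \<in> graph_complex G" for \<tau>
      using that by (auto simp: graph_complex_def card_insert_if)
    moreover assume "{t, v, w} \<in> graph_complex G"
    ultimately have "card {t, v, w} \<le> 2" .
    then show False using assms by simp
  qed
  ultimately have "?\<sigma> \<notin> A_complex p s G" using A_complex_iff[OF V] by simp
  then have zero: "cls (squarefree_monomial ?\<sigma>) = \<zero>\<^bsub>Q\<^esub>" by (rule sr_mod_class_nonface[OF finite_V V])
  have sum: "(\<Sum>v\<in>?\<sigma>. Poly_Mapping.single v 1) =
    Poly_Mapping.single (Y t) 1 + (Poly_Mapping.single (Y v) 1 + Poly_Mapping.single (Y w) (1 :: nat))"
    using assms by simp
  have k: "Poly_Mapping.keys (Poly_Mapping.single (Y u) (1 :: nat)) \<subseteq> V" if "u \<in> pverts G" for u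
    using that by (simp add: Y_in_V)
  have "Poly_Mapping.keys (Poly_Mapping.single (Y v) 1 + Poly_Mapping.single (Y w) (1 :: nat)) \<subseteq> V"
    using keys_add k[OF assms(2)] k[OF assms(3)] by (metis (no_types) Un_subset_iff order_trans)
  then have "cls (squarefree_monomial ?\<sigma>) = gen (Y t) \<otimes>\<^bsub>Q\<^esub> (gen (Y v) \<otimes>\<^bsub>Q\<^esub> gen (Y w))"
    unfolding squarefree_monomial_def sum gen_def
    using mon_add[OF k[OF assms(1)], of "Poly_Mapping.single (Y v) 1 + Poly_Mapping.single (Y w) 1"]
      mon_add[OF k[OF assms(2)] k[OF assms(3)]]
    by (simp only: mon_def)
  then show ?thesis using zero by simp
qed

text \<open>At the indicator of v the left side of \<open>ycoef_relation\<close> is 1^p and only u =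
  v survives on the right.\<close>

lemma vertex_pairing:
  assumes "of_nat p = (0 :: 'k::field)" "v \<in> pverts G"
  shows "(\<Sum>i\<in>{1..s 1}. ycoef (\<lambda>u. if u = v then 1 else 0 :: 'k) v i * xcoef i v) = 1"
proof -
  interpret graph_ev G p s P "\<lambda>u. if u = v then 1 else 0 :: 'k" "\<lambda>c. c :: 'k"
    by unfold_locales (use assms graph_admissible_indicator in auto)
  have "(\<Sum>u\<in>pverts G. xcoef i u * (if u = v then 1 else 0)) = (xcoef i v :: 'k)" for i
    using assms(2) by (simp add: if_distrib[of "\<lambda>x. _ * x"] cong: if_cong)
  then show ?thesis using ycoef_relation[OF assms(2)] by simp
qed

end

section \<open>The matrix of an edge\<close>

locale edge_steenrod = graph_steenrod G p s P
  for G :: "'v pair_pre_digraph" and p s P +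
  fixes v w :: 'v and field :: "'k::field itself"
  assumes vw: "(v, w) \<in> parcs G" and char_field: "of_nat p = (0 :: 'k)"
begin

abbreviation y1 :: "'k poly poly" where "y1 \<equiv> [:[:0, 1:]:]"
abbreviation y2 :: "'k poly poly" where "y2 \<equiv> [:0, 1:]"
abbreviation emb :: "'k \<Rightarrow> 'k poly poly" where "emb c \<equiv> [:[:c:]:]"

definition edge_sub :: "'v \<Rightarrow> 'k poly poly" where
  "edge_sub t = (if t = v then y1 else if t = w then y2 else 0)"

lemmas vw_facts = parcs_facts[OF vw]

lemma edge_sub_simps [simp]: "edge_sub v = y1" "edge_sub w = y2"
  using vw_facts by (simp_all add: edge_sub_def)

lemma graph_admissible_edge_sub: "graph_admissible edge_sub"
  unfolding graph_admissible_def
proof (intro conjI allI impI)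
  show "of_nat p = (0 :: 'k poly poly)" using char_field by (simp add: of_nat_poly)
  fix \<tau> assume \<tau>: "\<tau> \<subseteq> pverts G" "\<tau> \<notin> graph_complex G"
  have "\<not> \<tau> \<subseteq> {v, w}"
  proof
    assume "\<tau> \<subseteq> {v, w}"
    then consider "\<tau> = {}" | "\<tau> = {v}" | "\<tau> = {w}" | "\<tau> = {v, w}" by blast
    then show False using \<tau>(2) vw vw_facts by cases (auto simp: graph_complex_def)
  qed
  then obtain u where "u \<in> \<tau>" "u \<noteq> v" "u \<noteq> w" by blast
  moreover have "finite \<tau>" by (rule finite_subset[OF \<tau>(1)]) simp
  ultimately show "(\<Prod>t\<in>\<tau>. edge_sub t) = 0"
    by (intro prod_zero) (auto simp: edge_sub_def)
qed

sublocale graph_ev G p s P edge_sub emb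
  by unfold_locales (use graph_admissible_edge_sub char_field in \<open>auto simp: one_pCons\<close>)

text \<open>A third vertex t gives y_t y_v y_w = 0, while y_v y_w has the nonzero value y1 y2 in a
  domain. Sums over all vertices thus reduce to the two ends of the edge.\<close>

lemma annihilator_facts:
  assumes "t \<in> pverts G" "t \<noteq> v" "t \<noteq> w"
  shows "ycoef edge_sub t j = 0" and "comm0 (gen (Y t)) = 0"
proof -
  let ?y = "gen (Y v) \<otimes>\<^bsub>Q\<^esub> gen (Y w)"
  note c = gen_Y_carrier[OF vw_facts(1)] gen_Y_carrier[OF vw_facts(2)]
  note c' = Q.m_closed[OF c]
  note t = gen_Y_carrier[OF assms(1)]
  note zero = Y_triple_zero[OF assms(1) vw_facts(1,2) assms(2,3) vw_facts(3)]
  have "ev (sub1 edge_sub j) ?y = [:y1:] * [:y2:]"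
    using ev_mult[OF adm1 c, of j] ev_gen[OF adm1, of "Y v" j] ev_gen[OF adm1, of "Y w" j] vw_facts
    by (simp add: Y_in_V)
  then have "ev (sub1 edge_sub j) ?y \<noteq> 0" by simp
  from ev_P_annihilator[OF adm1 t c' zero this, of p]
  show "ycoef edge_sub t j = 0" by (simp add: ycoef_def ev1_def)
  have "N ?y = y1 * y2"
    using N_mult[OF c] N_gen[of "Y v"] N_gen[of "Y w"] vw_facts by (simp add: Y_in_V)
  then have "N ?y \<noteq> 0" by simp
  from ev_PP_annihilator[OF adm0 t c' zero this]
  show "comm0 (gen (Y t)) = 0" by (simp add: ev_comm_def)
qed

lemma sum_pverts:
  fixes f :: "'v \<Rightarrow> 'k poly poly"
  assumes "\<And>t. \<lbrakk>t \<in> pverts G; t \<noteq> v; t \<noteq> w\<rbrakk> \<Longrightarrow> f t = 0"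
  shows "(\<Sum>t\<in>pverts G. f t) = f v + f w"
proof -
  have "(\<Sum>t\<in>pverts G. f t) = (\<Sum>t\<in>{v, w}. f t)"
    by (rule sum.mono_neutral_right) (use assms vw_facts in auto)
  then show ?thesis using vw_facts(3) by simp
qed

abbreviation "H t i \<equiv> ycoef edge_sub t i"

definition M :: "'v \<Rightarrow> 'v \<Rightarrow> 'k poly poly" where
  "M t u = (\<Sum>i\<in>{1..s 1}. H t i * emb (xcoef i u))"

lemma M_relation:
  assumes "t \<in> {v, w}"
  shows "edge_sub t ^ p = y1 * M t v + y2 * M t w"
proof -
  have t: "t \<in> pverts G" using assms vw_facts by auto
  have "(\<Sum>u\<in>pverts G. emb (xcoef i u) * edge_sub u) = emb (xcoef i v) * y1 + emb (xcoef i w) * y2" for i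
    using vw_facts(3) by (subst sum_pverts) (auto simp: edge_sub_def)
  then have "edge_sub t ^ p = (\<Sum>i\<in>{1..s 1}. H t i * (emb (xcoef i v) * y1 + emb (xcoef i w) * y2))"
    using ycoef_relation[OF t] by simp
  also have "\<dots> = (\<Sum>i\<in>{1..s 1}. H t i * emb (xcoef i v)) * y1 + (\<Sum>i\<in>{1..s 1}. H t i * emb (xcoef i w)) * y2"
    unfolding sum_distrib_right sum.distrib[symmetric]
    by (intro sum.cong refl) (simp only: algebra_simps)
  finally show ?thesis unfolding M_def by (simp only: mult.commute)
qed

abbreviation "\<delta> \<equiv> bivar_deriv (comm0 (gen (Y v))) (comm0 (gen (Y w)))"

lemma \<delta>_edge_sub: "t \<in> pverts G \<Longrightarrow> \<delta> (edge_sub t) = comm0 (gen (Y t))"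
  using annihilator_facts(2)[of t] by (auto simp: edge_sub_def bivar_deriv_vars bivar_deriv_def[of _ _ 0])

lemma \<delta>_M:
  assumes "t \<in> {v, w}"
  shows "\<delta> (M t u) = - (M t v * M v u + M t w * M w u)"
proof -
  have t: "t \<in> pverts G" using assms vw_facts by auto
  have dH: "\<delta> (H t j) = - (M t v * H v j + M t w * H w j)" for j
  proof -
    have "(\<Sum>u\<in>pverts G. emb (xcoef i u) * H u j) = emb (xcoef i v) * H v j + emb (xcoef i w) * H w j" for i
      by (rule sum_pverts) (simp add: annihilator_facts(1))
    then have "\<delta> (H t j) = - (\<Sum>i\<in>{1..s 1}. H t i * (emb (xcoef i v) * H v j + emb (xcoef i w) * H w j))"
      using ycoef_derivation[OF bivar_deriv_add bivar_deriv_mult \<delta>_edge_sub t, of j] by simp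
    also have "(\<Sum>i\<in>{1..s 1}. H t i * (emb (xcoef i v) * H v j + emb (xcoef i w) * H w j))
      = M t v * H v j + M t w * H w j"
      unfolding M_def sum_distrib_right sum.distrib[symmetric]
      by (intro sum.cong refl) (simp only: algebra_simps)
    finally show ?thesis .
  qed
  have demb: "\<delta> (emb c) = 0" for c
  proof -
    have "map_poly pderiv (emb c) = 0"
      by (rule poly_eqI) (simp add: coeff_map_poly coeff_pCons split: nat.splits)
    then show ?thesis by (simp add: bivar_deriv_def)
  qed
  have d0: "\<delta> 0 = 0" by (simp add: bivar_deriv_def)
  have "\<delta> (sum f A) = (\<Sum>i\<in>A. \<delta> (f i))" for f :: "nat \<Rightarrow> _" and A
    by (induction A rule: infinite_finite_induct) (simp_all add: d0 bivar_deriv_add)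
  then have "\<delta> (M t u) = (\<Sum>i\<in>{1..s 1}. - (M t v * H v i + M t w * H w i) * emb (xcoef i u))"
    unfolding M_def[of t u] by (simp only: bivar_deriv_mult demb dH mult_zero_right add_0_right)
  also have "\<dots> = - (M t v * M v u + M t w * M w u)"
    unfolding M_def[of v u] M_def[of w u] sum_distrib_left sum.distrib[symmetric] sum_negf[symmetric]
    by (intro sum.cong refl) (simp only: algebra_simps mult_minus_left mult_minus_right minus_add_distrib)
  finally show ?thesis .
qed

text \<open>Sharpens the earlier degree count to exact exponents: r belongs to the outer variable y2
  and k to the inner variable y1.\<close>

lemma monomial_eval_edge_homogeneous:
  assumes "Poly_Mapping.keys m \<subseteq> V"
  shows "\<forall>r k. (coeff (coeff (coeff (monomial_eval (sub1 edge_sub j) m) 0) r) k \<noteq> 0 \<longrightarrow>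
        monomial_degree (A_degree p) m = (2 * p + 2) * (r + k)) \<and>
      (coeff (coeff (coeff (monomial_eval (sub1 edge_sub j) m) 1) r) k \<noteq> 0 \<longrightarrow>
        monomial_degree (A_degree p) m = 4 + (2 * p + 2) * (r + k))"
  using assms
proof (induction m rule: monomial_induct)
  case zero
  then show ?case by (auto simp: coeff_1 split: if_splits)
next
  case (add m g)
  let ?e = "monomial_eval (sub1 edge_sub j)" and ?d = "monomial_degree (A_degree p)"
  have e: "?e (m + Poly_Mapping.single g 1) = ?e m * sub1 edge_sub j g"
    and d: "?d (m + Poly_Mapping.single g 1) = ?d m + A_degree p g"
    by (simp_all add: monomial_eval_add monomial_degree_add)
  note c0 = add.IH[rule_format, THEN conjunct1, rule_format]
    and c1 = add.IH[rule_format, THEN conjunct2, rule_format]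
  show ?case
  proof (cases g)
    case (X k i)
    then show ?thesis unfolding e d coeff_mult_0 coeff_1_mult using c0 by auto
  next
    case (Y t)
    have s: "coeff (sub1 edge_sub j g) 0 = edge_sub t" "coeff (sub1 edge_sub j g) 1 = 0" using Y by simp_all
    have shift: "\<exists>r' k'. r + k = Suc (r' + k') \<and> coeff (coeff q r') k' \<noteq> 0"
      if "coeff (coeff (q * edge_sub t) r) k \<noteq> 0" for q :: "'k poly poly" and r k
    proof (cases "t = v")
      case True
      then have "k \<noteq> 0" "coeff (coeff q r) (k - 1) \<noteq> 0"
        using that by (auto simp: coeff_pCons split: nat.splits)
      then show ?thesis by (intro exI[of _ r] exI[of _ "k - 1"]) simp
    next
      case False
      then have "t = w" using that by (auto simp: edge_sub_def split: if_splits)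
      then have "r \<noteq> 0" "coeff (coeff q (r - 1)) k \<noteq> 0"
        using that by (auto simp: coeff_pCons split: nat.splits)
      then show ?thesis by (intro exI[of _ "r - 1"] exI[of _ k]) simp
    qed
    show ?thesis
      unfolding e d coeff_mult_0 coeff_1_mult s mult_zero_right add_0_right
    proof (intro allI conjI impI)
      fix r k
      assume "coeff (coeff (coeff (?e m) 0 * edge_sub t) r) k \<noteq> 0"
      then obtain r' k' where "r + k = Suc (r' + k')" "coeff (coeff (coeff (?e m) 0) r') k' \<noteq> 0"
        using shift by blast
      with c0[of r' k'] show "?d m + A_degree p g = (2 * p + 2) * (r + k)" using Y by simp
    next
      fix r k
      assume "coeff (coeff (coeff (?e m) 1 * edge_sub t) r) k \<noteq> 0"
      then obtain r' k' where "r + k = Suc (r' + k')" "coeff (coeff (coeff (?e m) 1) r') k' \<noteq> 0"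
        using shift by blast
      with c1[of r' k'] show "?d m + A_degree p g = 4 + (2 * p + 2) * (r + k)" using Y by simp
    qed
  qed
qed

lemma H_homogeneous:
  assumes t: "t \<in> pverts G" and nz: "coeff (coeff (H t j) r) k \<noteq> 0"
  shows "r + k = p - 1"
proof (rule ccontr)
  assume ne: "r + k \<noteq> p - 1"
  define \<psi> where "\<psi> z = coeff (coeff (L j z) r) k" for z
  have "\<psi> (P p (gen (Y t))) = 0"
  proof (rule additive_zero_grade)
    show "additive_map \<psi>"
      using additive_mapD[OF additive_map_ev1[OF \<eta>]] by (simp add: additive_map_def \<psi>_def)
    show "P p (gen (Y t)) \<in> grade Q (2 * p + 2 + 2 * p * (p - 1))"
      by (rule degree[OF gen_Y_grade[OF t]])
    fix m :: "'v gen monomial"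
    assume m: "Poly_Mapping.keys m \<subseteq> V" "monomial_degree (A_degree p) m = 2 * p + 2 + 2 * p * (p - 1)"
    obtain q where q: "p = Suc q" using p_ge_3 by (cases p) auto
    have "2 * p + 2 + 2 * p * (p - 1) = 4 + (2 * p + 2) * (p - 1)" unfolding q by simp
    moreover have "(2 * p + 2) * (p - 1) \<noteq> (2 * p + 2) * (r + k)"
      unfolding mult_cancel1 using ne by simp
    ultimately have "monomial_degree (A_degree p) m \<noteq> 4 + (2 * p + 2) * (r + k)"
      unfolding m(2) by linarith
    then show "\<psi> (mon m) = 0"
      using monomial_eval_edge_homogeneous[OF m(1), of j] unfolding \<psi>_def ev1_def ev_mon[OF adm1 m(1)] by blast
  qed
  then show False using nz by (simp add: \<psi>_def ycoef_def)
qed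

lemma degree_H: "t \<in> pverts G \<Longrightarrow> Polynomial.degree (H t j) < p"
proof -
  assume t: "t \<in> pverts G"
  have "Polynomial.degree (H t j) \<le> p - 1"
  proof (rule degree_le, intro allI impI)
    fix r assume "p - 1 < r"
    then show "coeff (H t j) r = 0"
      using H_homogeneous[OF t, of j r] by (intro poly_eqI) (metis coeff_0 le_add1 not_le)
  qed
  then show ?thesis using p_ge_3 by simp
qed

lemma degree_M: "t \<in> pverts G \<Longrightarrow> Polynomial.degree (M t u) < p"
proof -
  assume t: "t \<in> pverts G"
  have "Polynomial.degree (M t u) \<le> p - 1"
    unfolding M_def
  proof (rule degree_sum_le)
    fix i
    have "Polynomial.degree (H t i * emb (xcoef i u)) \<le> Polynomial.degree (H t i) + Polynomial.degree (emb (xcoef i u))"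
      by (rule degree_mult_le)
    then show "Polynomial.degree (H t i * emb (xcoef i u)) \<le> p - 1" using degree_H[OF t, of i] by simp
  qed simp
  then show ?thesis using p_ge_3 by simp
qed

lemma M_det_nonzero: "M v v * M w w \<noteq> M v w * M w v"
  using bivar_matrix_det_nonzero[of "M v v" "M v w" p "M w v" "M w w"] M_relation[of v] M_relation[of w]
  by simp

text \<open>Proportional vectors of coefficients would make the two columns of \<open>M\<close>
  proportional.\<close>

lemma xcoef_independent: "\<exists>i\<in>{1..s 1}. xcoef i v \<noteq> l * (xcoef i w :: 'k)"
proof (rule ccontr)
  assume "\<not> ?thesis"
  then have "M t v = emb l * M t w" for t
    unfolding M_def sum_distrib_left by (intro sum.cong refl) (auto simp: algebra_simps)
  then have "M v v * M w w = M v w * M w v" by (simp only: ac_simps)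
  then show False using M_det_nonzero by contradiction
qed

text \<open>Evaluation at (y1, y2) = (1, 0), while \<open>at_w\<close> below is evaluation at (0,
  1). On forms of degree p - 1 they extract the coefficients of the pure powers of y1 and
  y2.\<close>

definition at_v :: "'k poly poly \<Rightarrow> 'k" where "at_v f = poly (coeff f 0) 1"

definition at_w :: "'k poly poly \<Rightarrow> 'k" where "at_w f = coeff (poly f 1) 0"

lemma at_v_H:
  assumes "t \<in> pverts G"
  shows "at_v (H t i) = ycoef (\<lambda>u. if u = v then 1 else 0) t i"
proof -
  have *: "(\<lambda>t. at_v (edge_sub t)) = (\<lambda>u. if u = v then 1 else 0)"
    by (rule ext) (simp add: at_v_def edge_sub_def)
  have "at_v (H t i) = ev1 (\<lambda>t. at_v (edge_sub t)) i (P p (gen (Y t)))"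
    unfolding ycoef_def
  proof (rule ev1_hom[OF \<eta>])
    show "graph_admissible (\<lambda>t. at_v (edge_sub t))"
      unfolding * by (rule graph_admissible_indicator[OF char_field vw_facts(1)])
  qed (simp_all add: at_v_def coeff_mult_0 closed gen_Y_carrier[OF assms])
  then show ?thesis unfolding * ycoef_def .
qed

lemma at_w_H:
  assumes "t \<in> pverts G"
  shows "at_w (H t i) = ycoef (\<lambda>u. if u = w then 1 else 0) t i"
proof -
  have *: "(\<lambda>t. at_w (edge_sub t)) = (\<lambda>u. if u = w then 1 else 0)"
    using vw_facts by (intro ext) (simp add: at_w_def edge_sub_def)
  have "at_w (H t i) = ev1 (\<lambda>t. at_w (edge_sub t)) i (P p (gen (Y t)))"
    unfolding ycoef_def
  proof (rule ev1_hom[OF \<eta>])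
    show "graph_admissible (\<lambda>t. at_w (edge_sub t))"
      unfolding * by (rule graph_admissible_indicator[OF char_field vw_facts(2)])
  qed (simp_all add: at_w_def coeff_mult_0 closed gen_Y_carrier[OF assms])
  then show ?thesis unfolding * ycoef_def .
qed

text \<open>By homogeneity the only possible monomial with y2^(p-1) is that pure power, and its
  coefficient is the value at (0, 1).\<close>

lemma coeff_H_top:
  assumes t: "t \<in> pverts G" and zero: "at_w (H t i) = 0"
  shows "coeff (H t i) (p - 1) = 0"
proof (rule poly_eqI)
  fix k
  have "at_w (H t i) = (\<Sum>r\<le>Polynomial.degree (H t i). coeff (coeff (H t i) r) 0)"
    by (simp add: at_w_def poly_altdef coeff_sum)
  also have "\<dots> = (\<Sum>r\<le>p - 1. coeff (coeff (H t i) r) 0)"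
    using degree_H[OF t, of i] by (intro sum.mono_neutral_left) (auto simp: coeff_eq_0)
  also have "\<dots> = (\<Sum>r\<in>{p - 1}. coeff (coeff (H t i) r) 0)"
    using H_homogeneous[OF t, of i _ 0] by (intro sum.mono_neutral_right) auto
  finally have "coeff (coeff (H t i) (p - 1)) 0 = 0" using zero by simp
  then show "coeff (coeff (H t i) (p - 1)) k = coeff 0 k"
    using H_homogeneous[OF t, of i "p - 1" k] by (cases "k = 0") auto
qed

end

section \<open>Orthogonality along a path of length two\<close>

context graph_steenrod
begin

lemma orthogonal_neighbor:
  assumes vw: "(v, w) \<in> parcs G" and wu: "(w, u) \<in> parcs G" and uv: "u \<noteq> v"
    and char: "of_nat p = (0 :: 'k::field)"
  shows "(\<Sum>i\<in>{1..s 1}. ycoef (\<lambda>t. if t = v then 1 else 0 :: 'k) v i * xcoef i w) = 0"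
proof -
  interpret E: edge_steenrod G p s P v w "TYPE('k)" by unfold_locales (use vw char in auto)
  interpret F: edge_steenrod G p s P w u "TYPE('k)" by unfold_locales (use wu char in auto)
  note v = parcs_facts(1)[OF vw] and w = parcs_facts(2)[OF vw]
  \<comment> \<open>The value at y_w alone is the same on the edge vw and on the edge wu. On the
    latter v is a third vertex, so the value is 0; this is how the second neighbor u of w
    enters.\<close>
  have "E.at_w (E.H v i) = 0" for i
    using E.at_w_H[OF v, of i] F.at_v_H[OF v, of i] F.annihilator_facts(1)[OF v, of i] parcs_facts(3)[OF vw] uv
    by (auto simp: F.at_v_def)
  then have "coeff (E.H v i) (p - 1) = 0" for i by (rule E.coeff_H_top[OF v])
  then have "coeff (E.M v v) (p - 1) = 0"
    by (simp add: E.M_def coeff_sum mult.commute[of _ "[:_:]"])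
  moreover have "[:[:0, 1:]:] * E.M v v + [:0, 1:] * E.M v w = [:[:0, 1:]:] ^ p"
    "[:[:0, 1:]:] * E.M w v + [:0, 1:] * E.M w w = [:0, 1:] ^ p"
    using E.M_relation[of v] E.M_relation[of w] by simp_all
  ultimately have "E.M v w = 0"
    using p_ge_3 char of_nat_nonzero_below_char[OF prime_p char] E.degree_M[OF v] E.degree_M[OF w]
      E.\<delta>_M[of v v] E.\<delta>_M[of v w] E.\<delta>_M[of w v] E.\<delta>_M[of w w]
    by (intro bivar_riccati_triangular[of p "E.M v v" "E.M v w" "E.M w v" "E.M w w"
          "E.comm0 (gen (Y v))" "E.comm0 (gen (Y w))"]) auto
  then have "E.at_v (E.M v w) = 0" by (simp add: E.at_v_def)
  moreover have "E.at_v (E.M v w) = (\<Sum>i\<in>{1..s 1}. E.at_v (E.H v i) * xcoef i w)"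
    by (simp add: E.M_def E.at_v_def coeff_sum poly_sum coeff_mult_0 mult.commute)
  ultimately show ?thesis using E.at_v_H[OF v] by simp
qed

end

section \<open>Span colorings from functionals\<close>

lemma functional_vanishes_on_span:
  fixes c :: "nat \<Rightarrow> 'k::field"
  assumes S: "S \<subseteq> carrier_vec n" and zero: "\<And>x. x \<in> S \<Longrightarrow> (\<Sum>i<n. c i * x $ i) = 0"
    and x: "x \<in> LinearCombinations.module.span class_ring (module_vec TYPE('k) n) S"
  shows "(\<Sum>i<n. c i * x $ i) = 0"
proof -
  interpret vec_space "TYPE('k)" n .
  let ?N = "{x \<in> carrier_vec n. (\<Sum>i<n. c i * x $ i) = 0}"
  have "submodule class_ring ?N (module_vec TYPE('k) n)"
  proof (rule submodule.intro)
    show "module class_ring (module_vec TYPE('k) n)" by unfold_locales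
    fix v w assume "v \<in> ?N" "w \<in> ?N"
    then show "v \<oplus>\<^bsub>module_vec TYPE('k) n\<^esub> w \<in> ?N"
      by (auto simp: module_vec_simps distrib_left sum.distrib)
  next
    fix a :: 'k and v assume "v \<in> ?N"
    moreover from this have "(\<Sum>i<n. c i * (a \<cdot>\<^sub>v v) $ i) = a * (\<Sum>i<n. c i * v $ i)"
      unfolding sum_distrib_left by (intro sum.cong refl) auto
    ultimately show "a \<odot>\<^bsub>module_vec TYPE('k) n\<^esub> v \<in> ?N"
      by (auto simp: module_vec_simps)
  qed (auto simp: module_vec_simps)
  then have "span S \<subseteq> ?N" using S zero by (intro span_is_subset) auto
  then show ?thesis using x by auto
qed

lemma multiple_of_span_singleton:
  fixes y :: "'k::field vec"
  assumes y: "y \<in> carrier_vec n"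
    and x: "x \<in> LinearCombinations.module.span class_ring (module_vec TYPE('k) n) {y}"
  shows "\<exists>l. x = l \<cdot>\<^sub>v y"
proof -
  interpret vec_space "TYPE('k)" n .
  let ?N = "{l \<cdot>\<^sub>v y | l. True}"
  have "submodule class_ring ?N (module_vec TYPE('k) n)"
  proof (rule submodule.intro)
    show "module class_ring (module_vec TYPE('k) n)" by unfold_locales
    show "?N \<subseteq> carrier (module_vec TYPE('k) n)" using y by (auto simp: module_vec_simps)
    show "v \<oplus>\<^bsub>module_vec TYPE('k) n\<^esub> w \<in> ?N" if "v \<in> ?N" "w \<in> ?N" for v w
      using that by (auto simp: module_vec_simps simp flip: add_smult_distrib_vec)
    show "\<zero>\<^bsub>module_vec TYPE('k) n\<^esub> \<in> ?N"
      using y by (auto simp: module_vec_simps intro!: exI[of _ 0])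
    show "a \<odot>\<^bsub>module_vec TYPE('k) n\<^esub> v \<in> ?N" if "v \<in> ?N" for a v
      using that by (auto simp: module_vec_simps smult_smult_assoc)
  qed
  moreover have "y \<in> ?N" using y by (auto intro!: exI[of _ 1])
  ultimately have "span {y} \<subseteq> ?N" by (intro span_is_subset) auto
  then show ?thesis using x by auto
qed

text \<open>At a leaf \<open>w\<close> attached to a vertex \<open>v\<close> of higher degree, \<open>a w\<close> need not be killed by \<open>c v\<close>;
  its component along \<open>a v\<close> is removed.\<close>

lemma span_coloring_of_functionals:
  fixes a c :: "'v \<Rightarrow> nat \<Rightarrow> 'k::field"
  assumes G: "pair_graph G"
    and self: "\<And>v. v \<in> pverts G \<Longrightarrow> (\<Sum>i<n. c v i * a v i) = 1"
    and indep: "\<And>v w l. (v, w) \<in> parcs G \<Longrightarrow> \<exists>i<n. a v i \<noteq> l * a w i"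
    and orth: "\<And>v w u. \<lbrakk>(v, w) \<in> parcs G; (w, u) \<in> parcs G; u \<noteq> v\<rbrakk> \<Longrightarrow> (\<Sum>i<n. c v i * a w i) = 0"
  shows "\<exists>f :: 'v \<Rightarrow> 'k vec. span_coloring n G f"
proof -
  interpret pair_graph G by fact
  interpret vec_space "TYPE('k)" n .
  have sym: "(w, v) \<in> parcs G" if "(v, w) \<in> parcs G" for v w
    using pair_sym_arcs that by (auto simp: symmetric_def elim: symE)
  \<comment> \<open>The second condition excludes isolated edges, whose ends both keep their
    vectors. As a consequence the vertex v carrying a leaf is never modified itself.\<close>
  define leaf where "leaf w v \<longleftrightarrow> neighbors G w = {v} \<and> neighbors G v \<noteq> {w}" for w v
  define dot where "dot v b = (\<Sum>i<n. c v i * b i)" for v b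
  define h where "h w = (if \<exists>v. leaf w v then (let v = THE v. leaf w v in (\<lambda>i. a w i - dot v (a w) * a v i)) else a w)" for w
  have h_leaf: "h w = (\<lambda>i. a w i - dot v (a w) * a v i)" if "leaf w v" for w v
  proof -
    have "(THE v. leaf w v) = v" using that by (intro the_equality) (auto simp: leaf_def)
    then show ?thesis using that by (auto simp: h_def)
  qed
  have h_nonleaf: "h w = a w" if "\<nexists>v. leaf w v" for w using that by (simp add: h_def)
  define f where "f w = vec n (h w)" for w
  have f_carrier: "f ` A \<subseteq> carrier_vec n" for A by (auto simp: f_def)
  have dot_diff: "dot v (\<lambda>i. b i - l * b' i) = dot v b - l * dot v b'" for v b b' l
    by (simp add: dot_def algebra_simps sum_subtractf sum_distrib_left)
  have not_span: "f v \<notin> span (f ` neighbors G v)" if v: "v \<in> pverts G" for v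
  \<comment> \<open>A vertex with exactly one neighbor is handled by independence, all others,
    isolated vertices included, by the functional \<open>c v\<close>.\<close>
  proof (cases "\<exists>w. neighbors G v = {w}")
    case True
    then obtain w where w: "neighbors G v = {w}" by blast
    then have vw: "(v, w) \<in> parcs G" by (auto simp: neighbors_def)
    have hw: "h w = a w"
    proof (rule h_nonleaf)
      show "\<nexists>u. leaf w u"
      proof
        assume "\<exists>u. leaf w u"
        then obtain u where u: "neighbors G w = {u}" "neighbors G u \<noteq> {w}" by (auto simp: leaf_def)
        moreover have "v \<in> neighbors G w" using sym[OF vw] by (simp add: neighbors_def)
        ultimately show False using w by auto
      qed
    qed
    \<comment> \<open>Subtracting a multiple of a_w leaves the comparison with a_w intact; l = 0
      covers isolated edges.\<close>
    obtain l where hv: "h v = (\<lambda>i. a v i - l * a w i)"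
    proof (cases "leaf v w")
      case True
      then show ?thesis using that h_leaf by blast
    next
      case False
      then have "\<nexists>u. leaf v u" using w by (auto simp: leaf_def)
      then show ?thesis using that[of 0] h_nonleaf[of v] by simp
    qed
    show ?thesis
    proof
      assume "f v \<in> span (f ` neighbors G v)"
      then have "f v \<in> span {f w}" using w by simp
      then obtain k where k: "f v = k \<cdot>\<^sub>v f w"
        using multiple_of_span_singleton[of "f w" n "f v"] f_carrier[of "{w}"] by auto
      have "a v i = (l + k) * a w i" if "i < n" for i
      proof -
        have "f v $ i = k * f w $ i" using that unfolding k by (simp add: f_def)
        then show ?thesis using that hw by (simp add: f_def hv algebra_simps)
      qed
      then show False using indep[OF vw, of "l + k"] by blast
    qed
  next
    case False
    then have hv: "h v = a v" by (intro h_nonleaf) (auto simp: leaf_def)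
    show ?thesis
    proof
      assume mem: "f v \<in> span (f ` neighbors G v)"
      have "(\<Sum>i<n. c v i * f v $ i) = 0"
      proof (rule functional_vanishes_on_span[OF f_carrier _ mem])
        fix x assume "x \<in> f ` neighbors G v"
        then obtain w where w: "(v, w) \<in> parcs G" "x = f w" by (auto simp: neighbors_def)
        have "dot v (h w) = 0"
        proof (cases "neighbors G w = {v}")
          case True
          \<comment> \<open>The corrected vector satisfies c_v . h_w = c_v . a_w - (c_v . a_w) (c_v
            . a_v), which is 0 because c_v . a_v = 1.\<close>
          then have "leaf w v" using False by (auto simp: leaf_def)
          then show ?thesis
            using self[OF v] by (simp add: h_leaf dot_diff) (simp add: dot_def)
        next
          case nw: False
          moreover have "v \<in> neighbors G w" using sym[OF w(1)] by (simp add: neighbors_def)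
          ultimately obtain u where u: "(w, u) \<in> parcs G" "u \<noteq> v" by (auto simp: neighbors_def)
          have "\<nexists>u. leaf w u" using nw \<open>v \<in> neighbors G w\<close> by (auto simp: leaf_def)
          then show ?thesis using orth[OF w(1) u] h_nonleaf[of w] by (simp add: dot_def)
        qed
        then show "(\<Sum>i<n. c v i * x $ i) = 0" by (simp add: w(2) f_def dot_def)
      qed
      moreover have "(\<Sum>i<n. c v i * f v $ i) = (\<Sum>i<n. c v i * a v i)"
        by (simp add: f_def hv)
      ultimately show False using self[OF v] by simp
    qed
  qed
  \<comment> \<open>Zero lies in every span, so \<open>not_span\<close> also shows that the colors
    are nonzero.\<close>
  have "0\<^sub>v n \<in> span A" if "A \<subseteq> carrier_vec n" for A
    using span_zero by blast
  then have "span_coloring n G f"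
    unfolding span_coloring_def using not_span f_carrier by (auto simp: f_def) metis+
  then show ?thesis by blast
qed

section \<open>The coloring of the graph\<close>

context graph_steenrod
begin

lemma span_coloring_exists:
  assumes char: "of_nat p = (0 :: 'k::field)"
  shows "\<exists>f :: 'v \<Rightarrow> 'k vec. span_coloring (s 1) G f"
proof (rule span_coloring_of_functionals)
  define c where "c v i = ycoef (\<lambda>t. if t = v then 1 else 0 :: 'k) v (Suc i)" for v i
  define a where "a v i = (xcoef (Suc i) v :: 'k)" for v i
  \<comment> \<open>Vector coordinates count from 0, the generators \<open>X 1 i\<close> from
    1.\<close>
  have shift: "(\<Sum>i<s 1. f (Suc i)) = (\<Sum>i\<in>{1..s 1}. f i)" for f :: "nat \<Rightarrow> 'k"
    by (metis One_nat_def sum.atLeast1_atMost_eq)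
  show "pair_graph G" by unfold_locales
  show "(\<Sum>i<s 1. c v i * a v i) = 1" if "v \<in> pverts G" for v
    unfolding c_def a_def shift[of "\<lambda>i. ycoef (\<lambda>t. if t = v then 1 else 0) v i * xcoef i v"]
    by (rule vertex_pairing[OF char that])
  show "(\<Sum>i<s 1. c v i * a w i) = 0" if "(v, w) \<in> parcs G" "(w, u) \<in> parcs G" "u \<noteq> v" for v w u
    unfolding c_def a_def shift[of "\<lambda>i. ycoef (\<lambda>t. if t = v then 1 else 0) v i * xcoef i w"]
    by (rule orthogonal_neighbor[OF that char])
  show "\<exists>i<s 1. a v i \<noteq> l * a w i" if "(v, w) \<in> parcs G" for v w l
  proof -
    interpret edge_steenrod G p s P v w "TYPE('k)" by unfold_locales (use that char in auto)
    obtain i where "i \<in> {1..s 1}" "xcoef i v \<noteq> l * (xcoef i w :: 'k)" using xcoef_independent by blast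
    then show ?thesis by (intro exI[of _ "i - 1"]) (auto simp: a_def)
  qed
qed

end

theorem theoremC:
  fixes p :: nat and s :: "nat \<Rightarrow> nat" and G :: "'v pair_pre_digraph"
  assumes "p = CARD('p::prime_card)" and "odd p"
    and "pair_graph G"
    and "\<exists>P. steenrod_structure p (tensor_Zmod (A_ring p s G) p) P"
  shows "span_chromatic_number TYPE('p mod_ring) G \<le> s 1"
proof -
  obtain P where "steenrod_structure p (tensor_Zmod (A_ring p s G) p) P" using assms(4) by blast
  then interpret graph_steenrod G p s P
    using assms prime_card[where 'a = 'p]
    by (intro graph_steenrod.intro graph_steenrod_axioms.intro) auto
  have "of_nat p = (0 :: 'p mod_ring)" using assms(1) by (simp add: of_nat_card_eq_0)
  then have "\<exists>f :: 'v \<Rightarrow> 'p mod_ring vec. span_coloring (s 1) G f" by (rule span_coloring_exists)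
  then show ?thesis unfolding span_chromatic_number_def by (rule Least_le)
qed

end
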